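(* Let $G$ be a group, and suppose that $\mathcal{B}\subseteq\mathcal{P}(G)$ is a left-invariant Boolean algebra such that every set in $\mathcal{B}$ is stable in $G$. \begin{enumerate} \item[(a)] There is a unique left-invariant probability measure $\mu$ on $\mathcal{B}$. \item[(b)] If $A\in\mathcal{B}$, then $\mu(A)>0$ if and only if $A$ is generic. \item[(c)] Suppose $A\in\mathcal{B}$. Then there is a finite-index subgroup $H\leq G$ with $H\in\mathcal{B}$, and a set $Y\subseteq G$ which is a union of left cosets of $H$, such that $\mu(A\,\triangle\, Y)=0$. Consequently, if $\mathcal{C}$ is the set of left cosets of $H$ contained in $Y$, then $\mu(A)=\mu(Y)=|\mathcal{C}|/[G:H]$. \end{enumerate} Moreover, if $\mathcal{B}$ is bi-invariant, then $\mu$ is bi-invariant and is also the unique right-invariant probability measure on $\mathcal{B}$; and in part (c) the subgroup $H$ may be chosen to be a normal subgroup of $G$.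
   Context: $G$ is an arbitrary group (no topology). A set $A\subseteq G$ is stable in $G$ if there do not exist an infinite linearly ordered set $I$ and sequences $(a_i)_{i\in I}$, $(b_i)_{i\in I}$ of elements of $G$ such that $a_ib_j\in A$ if and only if $i\leq j$. A set $A\subseteq G$ is generic if $G=FA$ for some finite $F\subseteq G$ (i.e. finitely many left translates of $A$ cover $G$). A Boolean algebra $\mathcal{B}\subseteq\mathcal{P}(G)$ (of subsets of $G$) is left-invariant if $gA\in\mathcal{B}$ for all $g\in G$, $A\in\mathcal{B}$, and bi-invariant if moreover $Ag\in\mathcal{B}$ for all $g\in G$, $A\in\mathcal{B}$. A probability measure on $\mathcal{B}$ is a finitely additive function $\mu:\mathcal{B}\to[0,1]$ with $\mu(G)=1$; it is left-invariant (resp. right-invariant) if $\mu(gA)=\mu(A)$ (resp. $\mu(Ag)=\mu(A)$) for all $g\in G$, $A\in\mathcal{B}$, and bi-invariant if both. *)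

theory Defs
  imports "HOL-Algebra.Left_Coset" "HOL-Analysis.Measure_Space"
begin

text \<open>
  A set is stable if no infinite linear order \<open>(I, r)\<close> is coded by the relation \<open>a i \<otimes> b j \<in> A\<close>.
  The index sets are taken inside the type of the group elements; this is no restriction, since the
  map \<open>a\<close> of such a configuration is necessarily injective (lemma \<open>stable_in_any_index\<close> below).
\<close>

definition stable_in :: "('a, 'm) monoid_scheme \<Rightarrow> 'a set \<Rightarrow> bool" where
  "stable_in G A \<longleftrightarrow>
     \<not> (\<exists>(I :: 'a set) r a b. infinite I \<and> linear_order_on I r \<and>
          a \<in> I \<rightarrow> carrier G \<and> b \<in> I \<rightarrow> carrier G \<and>
          (\<forall>i\<in>I. \<forall>j\<in>I. a i \<otimes>\<^bsub>G\<^esub> b j \<in> A \<longleftrightarrow> (i, j) \<in> r))"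

lemma stable_in_any_index:
  fixes G :: "('a, 'm) monoid_scheme" and I :: "'i set"
  assumes st: "stable_in G A" and inf: "infinite I" and lin: "linear_order_on I r"
    and a: "a \<in> I \<rightarrow> carrier G" and b: "b \<in> I \<rightarrow> carrier G"
  shows "\<not> (\<forall>i\<in>I. \<forall>j\<in>I. a i \<otimes>\<^bsub>G\<^esub> b j \<in> A \<longleftrightarrow> (i, j) \<in> r)"
proof
  assume code: "\<forall>i\<in>I. \<forall>j\<in>I. a i \<otimes>\<^bsub>G\<^esub> b j \<in> A \<longleftrightarrow> (i, j) \<in> r"
  have rI: "r \<subseteq> I \<times> I" and rrefl: "\<And>i. i \<in> I \<Longrightarrow> (i, i) \<in> r" and rtrans: "trans r"
    and ranti: "antisym r" and rtot: "total_on I r"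
    using lin by (auto simp: order_on_defs refl_on_def)
  have inj: "inj_on a I"
  proof (rule inj_onI)
    fix i j assume ij: "i \<in> I" "j \<in> I" "a i = a j"
    have "(i, j) \<in> r" "(j, i) \<in> r" using code ij rrefl by metis+
    then show "i = j" using ranti by (meson antisymD)
  qed
  define c where "c = inv_into I a"
  have c: "c (a i) = i" if "i \<in> I" for i
    using inj that by (simp add: c_def)
  define s where "s = {(x, y). x \<in> a ` I \<and> y \<in> a ` I \<and> (c x, c y) \<in> r}"
  have lin': "linear_order_on (a ` I) s"
    unfolding order_on_defs
  proof (intro conjI)
    show "s \<subseteq> a ` I \<times> a ` I" by (auto simp: s_def)
    show "refl_on (a ` I) s" by (auto simp: s_def refl_on_def c rrefl)
    show "trans s"
      unfolding s_def using transD[OF rtrans] by (intro transI) (simp, metis)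
    show "antisym s"
    proof (rule antisymI)
      fix x y assume "(x, y) \<in> s" "(y, x) \<in> s"
      then obtain i j where "i \<in> I" "j \<in> I" "x = a i" "y = a j" "(i, j) \<in> r" "(j, i) \<in> r"
        by (auto simp: s_def c)
      then show "x = y" using antisymD[OF ranti, of i j] by simp
    qed
    show "total_on (a ` I) s" using rtot by (auto simp: s_def c total_on_def)
  qed
  moreover have "infinite (a ` I)" using inf inj finite_imageD by blast
  moreover have "id \<in> a ` I \<rightarrow> carrier G" using a by auto
  moreover have "b \<circ> c \<in> a ` I \<rightarrow> carrier G" using b by (auto simp: c)
  moreover have "\<forall>x\<in>a ` I. \<forall>y\<in>a ` I. id x \<otimes>\<^bsub>G\<^esub> (b \<circ> c) y \<in> A \<longleftrightarrow> (x, y) \<in> s"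
    using code by (auto simp: s_def c)
  ultimately have "\<exists>(I :: 'a set) r a b. infinite I \<and> linear_order_on I r \<and>
      a \<in> I \<rightarrow> carrier G \<and> b \<in> I \<rightarrow> carrier G \<and>
      (\<forall>i\<in>I. \<forall>j\<in>I. a i \<otimes>\<^bsub>G\<^esub> b j \<in> A \<longleftrightarrow> (i, j) \<in> r)"
    by (intro exI[of _ "a ` I"] exI[of _ s] exI[of _ id] exI[of _ "b \<circ> c"] conjI)
  then show False using st unfolding stable_in_def by (rule notE[rotated])
qed

definition generic_in :: "('a, 'm) monoid_scheme \<Rightarrow> 'a set \<Rightarrow> bool" where
  "generic_in G A \<longleftrightarrow> (\<exists>F. finite F \<and> F \<subseteq> carrier G \<and> carrier G = F <#>\<^bsub>G\<^esub> A)"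

definition left_invariant_sets :: "('a, 'm) monoid_scheme \<Rightarrow> 'a set set \<Rightarrow> bool" where
  "left_invariant_sets G \<B> \<longleftrightarrow> (\<forall>g\<in>carrier G. \<forall>A\<in>\<B>. g <#\<^bsub>G\<^esub> A \<in> \<B>)"

definition bi_invariant_sets :: "('a, 'm) monoid_scheme \<Rightarrow> 'a set set \<Rightarrow> bool" where
  "bi_invariant_sets G \<B> \<longleftrightarrow>
     left_invariant_sets G \<B> \<and> (\<forall>g\<in>carrier G. \<forall>A\<in>\<B>. A #>\<^bsub>G\<^esub> g \<in> \<B>)"

text \<open>
  A measure on \<open>\<B>\<close> has domain \<open>\<B>\<close>; the extensional function space makes equality
  of such measures mean agreement on \<open>\<B>\<close>.
\<close>

definition fin_add_prob :: "('a, 'm) monoid_scheme \<Rightarrow> 'a set set \<Rightarrow> ('a set \<Rightarrow> real) \<Rightarrow> bool" where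
  "fin_add_prob G \<B> \<mu> \<longleftrightarrow>
     \<mu> \<in> \<B> \<rightarrow>\<^sub>E {0..1} \<and> Measure_Space.additive \<B> \<mu> \<and> \<mu> (carrier G) = 1"

definition left_invariant_prob :: "('a, 'm) monoid_scheme \<Rightarrow> 'a set set \<Rightarrow> ('a set \<Rightarrow> real) \<Rightarrow> bool" where
  "left_invariant_prob G \<B> \<mu> \<longleftrightarrow>
     fin_add_prob G \<B> \<mu> \<and> (\<forall>g\<in>carrier G. \<forall>A\<in>\<B>. \<mu> (g <#\<^bsub>G\<^esub> A) = \<mu> A)"

definition right_invariant_prob :: "('a, 'm) monoid_scheme \<Rightarrow> 'a set set \<Rightarrow> ('a set \<Rightarrow> real) \<Rightarrow> bool" where
  "right_invariant_prob G \<B> \<mu> \<longleftrightarrow>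
     fin_add_prob G \<B> \<mu> \<and> (\<forall>g\<in>carrier G. \<forall>A\<in>\<B>. \<mu> (A #>\<^bsub>G\<^esub> g) = \<mu> A)"

definition bi_invariant_prob :: "('a, 'm) monoid_scheme \<Rightarrow> 'a set set \<Rightarrow> ('a set \<Rightarrow> real) \<Rightarrow> bool" where
  "bi_invariant_prob G \<B> \<mu> \<longleftrightarrow> left_invariant_prob G \<B> \<mu> \<and> right_invariant_prob G \<B> \<mu>"

text \<open>
  \<open>H\<close> is a finite-index subgroup lying in \<open>\<B>\<close>, and \<open>Y\<close> is a union of left cosets of \<open>H\<close>
  which agrees with \<open>A\<close> up to a \<open>\<mu>\<close>-null set.
\<close>

definition coset_approx ::
    "('a, 'm) monoid_scheme \<Rightarrow> 'a set set \<Rightarrow> ('a set \<Rightarrow> real) \<Rightarrow> 'a set \<Rightarrow> 'a set \<Rightarrow> 'a set \<Rightarrow> bool" where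
  "coset_approx G \<B> \<mu> A H Y \<longleftrightarrow>
     subgroup H G \<and> finite (lcosets\<^bsub>G\<^esub> H) \<and> H \<in> \<B> \<and>
     (\<exists>\<D> \<subseteq> lcosets\<^bsub>G\<^esub> H. Y = \<Union>\<D>) \<and> \<mu> (sym_diff A Y) = 0"

end

theory Submission
  imports Defs "HOL-Library.Ramsey" "HOL-Analysis.Function_Topology"
begin

text \<open>
  Fix a left-invariant ideal \<open>\<I>\<close> of subsets of \<open>G\<close> that is maximal among proper ones; maximality means
  that finitely many translates of any set outside \<open>\<I>\<close> cover \<open>G\<close> up to a member of \<open>\<I>\<close>.

  Stability of \<open>A\<close> enters through definability of types: a set that is finitely approximated by the
  sections of a relation without half graphs depends on finitely many of these sections only. Hence
  countably many sections have countably many limits, so no perfect tree of sets outside \<open>\<I>\<close> can be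
  split off by translates of \<open>A\<close>. Some set outside \<open>\<I>\<close> is therefore split by no translate of \<open>A\<close>, and
  \<open>A\<close> has only finitely many translates modulo \<open>\<I>\<close>. On a finite-index normal subgroup \<open>N\<close> stabilizing
  all of these, \<open>A\<close> is small or full on every coset of \<open>N\<close>.

  If \<open>A\<close> were full on a coset with respect to one maximal ideal, but its inverse small there with respect
  to another, one could choose \<open>x\<^sub>n\<close> in the coset and \<open>y\<^sub>n\<close> in \<open>N\<close> alternately and generically so that
  \<open>x\<^sub>i y\<^sub>j \<in> A\<close> iff \<open>i \<le> j\<close>. So all maximal ideals have the same stable members, and these are
  also invariant under inversion, hence under right translation. Every non-generic set lies in such an
  ideal, and any invariant measure vanishes on the stable members, again because a half graph could
  be built otherwise. The measure of \<open>A\<close> is the density of the union of cosets that approximates it.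
\<close>

section \<open>Relations without half graphs\<close>

text \<open>The two clauses exclude the half graphs indexed by omega and by its reverse. Both are
  listed because neither infinite pattern has to contain the other.\<close>

definition half_graph_free :: "('x \<Rightarrow> 'y \<Rightarrow> bool) \<Rightarrow> 'x set \<Rightarrow> 'y set \<Rightarrow> bool" where
  "half_graph_free R X Y \<longleftrightarrow>
     (\<nexists>(a :: nat \<Rightarrow> 'x) b. range a \<subseteq> X \<and> range b \<subseteq> Y \<and> (\<forall>i j. R (a i) (b j) \<longleftrightarrow> i \<le> j)) \<and>
     (\<nexists>(a :: nat \<Rightarrow> 'x) b. range a \<subseteq> X \<and> range b \<subseteq> Y \<and> (\<forall>i j. R (a i) (b j) \<longleftrightarrow> j \<le> i))"

lemma half_graph_freeI:
  assumes "\<And>(a :: nat \<Rightarrow> 'x) b. range a \<subseteq> X \<Longrightarrow> range b \<subseteq> Y \<Longrightarrow> \<not> (\<forall>i j. R (a i) (b j) \<longleftrightarrow> i \<le> j)"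
    and "\<And>(a :: nat \<Rightarrow> 'x) b. range a \<subseteq> X \<Longrightarrow> range b \<subseteq> Y \<Longrightarrow> \<not> (\<forall>i j. R (a i) (b j) \<longleftrightarrow> j \<le> i)"
  shows "half_graph_free R X Y"
  unfolding half_graph_free_def
proof (intro conjI notI; elim exE conjE)
  fix a :: "nat \<Rightarrow> 'x" and b
  assume "range a \<subseteq> X" "range b \<subseteq> Y" "\<forall>i j. R (a i) (b j) \<longleftrightarrow> i \<le> j"
  then show False by (rule notE[OF assms(1)])
next
  fix a :: "nat \<Rightarrow> 'x" and b
  assume "range a \<subseteq> X" "range b \<subseteq> Y" "\<forall>i j. R (a i) (b j) \<longleftrightarrow> j \<le> i"
  then show False by (rule notE[OF assms(2)])
qed

lemma half_graph_free_le:
  assumes "half_graph_free R X Y" "range a \<subseteq> X" "range b \<subseteq> Y"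
  shows "\<not> (\<forall>i j :: nat. R (a i) (b j) \<longleftrightarrow> i \<le> j)"
  using assms unfolding half_graph_free_def by blast

lemma half_graph_free_ge:
  assumes "half_graph_free R X Y" "range a \<subseteq> X" "range b \<subseteq> Y"
  shows "\<not> (\<forall>i j :: nat. R (a i) (b j) \<longleftrightarrow> j \<le> i)"
  using assms unfolding half_graph_free_def by blast

lemma half_graph_free_mono:
  assumes "half_graph_free R X Y" "X' \<subseteq> X" "Y' \<subseteq> Y"
  shows "half_graph_free R X' Y'"
  using assms unfolding half_graph_free_def by (meson order_trans)

text \<open>Dependent choice with full memory: the requirement \<open>P h s\<close> may mention
  every earlier choice. The half graphs below are built with it, term by term.\<close>

lemma history_choice:
  assumes "\<And>h. h \<in> lists S \<Longrightarrow> \<exists>s\<in>S. P h s"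
  obtains f :: "nat \<Rightarrow> 's" where "\<And>n. f n \<in> S" "\<And>n. P (map f [0..<n]) (f n)"
proof -
  have "\<exists>s. h \<in> lists S \<longrightarrow> s \<in> S \<and> P h s" for h
    using assms by blast
  then obtain c where c: "\<And>h. h \<in> lists S \<Longrightarrow> c h \<in> S \<and> P h (c h)"
    by metis
  define hs where "hs = rec_nat [] (\<lambda>_ h. h @ [c h])"
  define f where "f n = c (hs n)" for n
  have hs: "hs n = map f [0..<n]" for n
    by (induction n) (simp_all add: hs_def f_def)
  have "hs n \<in> lists S" for n
  proof (induction n)
    case (Suc n)
    then show ?case using c[of "hs n"] by (simp add: hs_def)
  qed (simp add: hs_def)
  then show ?thesis
    using that[of f] c hs by (metis f_def)
qed

text \<open>If no finite \<open>F\<close> decided membership in \<open>D\<close>, one could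
  alternately choose \<open>x\<close> that approximates \<open>D\<close> on everything chosen so
  far, and a pair \<open>y\<close> in \<open>D\<close>, \<open>z\<close> outside \<open>D\<close>
  that the chosen \<open>x\<close> do not separate. Ramsey's theorem then extracts a half graph from
  the \<open>x\<close> together with either the \<open>y\<close> or the \<open>z\<close>.\<close>

lemma definability:
  assumes free: "half_graph_free R X Y"
    and appr: "\<And>Z. finite Z \<Longrightarrow> Z \<subseteq> Y \<Longrightarrow> \<exists>x\<in>X. \<forall>y\<in>Z. R x y \<longleftrightarrow> y \<in> D"
  shows "\<exists>F. finite F \<and> F \<subseteq> X \<and>
           (\<forall>y\<in>Y. \<forall>z\<in>Y. (\<forall>x\<in>F. R x y \<longleftrightarrow> R x z) \<longrightarrow> (y \<in> D \<longleftrightarrow> z \<in> D))"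
proof (rule ccontr)
  assume contr: "\<not> ?thesis"
  have undet: "\<exists>y\<in>Y. \<exists>z\<in>Y. (\<forall>x\<in>F. R x y \<longleftrightarrow> R x z) \<and> (y \<in> D) \<noteq> (z \<in> D)"
    if F: "finite F" "F \<subseteq> X" for F
  proof (rule ccontr)
    assume none: "\<not> ?thesis"
    have "\<forall>y\<in>Y. \<forall>z\<in>Y. (\<forall>x\<in>F. R x y \<longleftrightarrow> R x z) \<longrightarrow> (y \<in> D \<longleftrightarrow> z \<in> D)"
      using none by blast
    then show False using contr F by blast
  qed
  \<comment> \<open>One stage is a triple: \<open>x\<close> sorts all earlier \<open>y'\<close> and
    \<open>z'\<close> correctly, and then \<open>y\<close>, \<open>z\<close> are a pair which
    neither the earlier \<open>x'\<close> nor \<open>x\<close> itself tells apart.\<close>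
  define S where "S = X \<times> (Y \<inter> D) \<times> (Y - D)"
  define P where "P h s = (case s of (x, y, z) \<Rightarrow>
      (\<forall>(x', y', z') \<in> set h. R x y' \<and> \<not> R x z' \<and> (R x' y \<longleftrightarrow> R x' z)) \<and> (R x y \<longleftrightarrow> R x z))" for h s
  have step: "\<exists>s\<in>S. P h s" if h: "h \<in> lists S" for h
  proof -
    let ?Z = "(fst \<circ> snd) ` set h \<union> (snd \<circ> snd) ` set h"
    have "set h \<subseteq> S" using h by auto
    then have "?Z \<subseteq> Y" by (auto simp: S_def)
    then obtain x where x: "x \<in> X" "\<forall>y\<in>?Z. R x y \<longleftrightarrow> y \<in> D"
      using appr[of ?Z] by auto
    have "finite (insert x (fst ` set h))" "insert x (fst ` set h) \<subseteq> X"
      using h x by (auto simp: S_def)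
    from undet[OF this] obtain y z where yz: "y \<in> Y" "z \<in> Y"
      "\<forall>x'\<in>insert x (fst ` set h). R x' y \<longleftrightarrow> R x' z" "(y \<in> D) \<noteq> (z \<in> D)"
      by (elim bexE conjE)
    obtain y z where yz: "y \<in> Y \<inter> D" "z \<in> Y - D"
      "\<forall>x'\<in>insert x (fst ` set h). R x' y \<longleftrightarrow> R x' z"
    proof (cases "y \<in> D")
      case True
      then show ?thesis using yz that[of y z] by blast
    next
      case False
      then show ?thesis using yz that[of z y] by blast
    qed
    have "R x y' \<and> \<not> R x z' \<and> (R x' y \<longleftrightarrow> R x' z)" if "(x', y', z') \<in> set h" for x' y' z'
    proof -
      have "(x', y', z') \<in> S" using that h by blast
      then have "y' \<in> D" "z' \<notin> D" by (auto simp: S_def)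
      moreover have "y' \<in> ?Z" "z' \<in> ?Z" "x' \<in> fst ` set h" using that by force+
      ultimately show ?thesis using x(2) yz(3) by blast
    qed
    then have "P h (x, y, z)" using yz(3) by (auto simp: P_def)
    moreover have "(x, y, z) \<in> S" using x yz by (auto simp: S_def)
    ultimately show ?thesis by blast
  qed
  obtain f where f: "\<And>n. f n \<in> S" "\<And>n. P (map f [0..<n]) (f n)"
    using history_choice[of S P] step by metis
  define x y z where xyz: "x n = fst (f n)" "y n = fst (snd (f n))" "z n = snd (snd (f n))" for n
  have f_eq: "f n = (x n, y n, z n)" for n by (simp add: xyz)
  have rng: "x n \<in> X" "y n \<in> Y" "z n \<in> Y" for n
    using f(1)[of n] by (auto simp: f_eq S_def)
  have below: "R (x n) (y m)" "\<not> R (x n) (z m)" if "m < n" for m n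
    using f(2)[of n] that by (force simp: P_def f_eq)+
  have above: "R (x m) (y n) \<longleftrightarrow> R (x m) (z n)" if "m < n" for m n
    using f(2)[of n] that by (force simp: P_def f_eq)
  \<comment> \<open>For a larger index on \<open>x\<close> the relation is already known; the colour
    records its value for a smaller index on \<open>x\<close>.\<close>
  define col where "col E = (if R (x (Min E)) (y (Max E)) then 1 else (0::nat))" for E
  have "\<forall>i\<in>UNIV. \<forall>j\<in>UNIV. i \<noteq> j \<longrightarrow> col {i, j} < 2" by (simp add: col_def)
  then obtain K t where K: "infinite K" "\<forall>i\<in>K. \<forall>j\<in>K. i \<noteq> j \<longrightarrow> col {i, j} = t"
    using Ramsey2[of "UNIV :: nat set" col 2] by auto
  define k where "k = enumerate K"
  have k: "k i \<in> K" "i < j \<longleftrightarrow> k i < k j" for i j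
    using K(1) by (auto simp: k_def enumerate_in_set)
  have col: "R (x (k i)) (y (k j)) \<longleftrightarrow> t = 1" if "i < j" for i j
  proof -
    have less: "k i < k j" using k(2) that by blast
    then have "col {k i, k j} = t" using K(2) k(1) by auto
    moreover have "Min {k i, k j} = k i" "Max {k i, k j} = k j" using less by auto
    ultimately show ?thesis by (auto simp: col_def split: if_splits)
  qed
  show False
  proof (cases "t = 1")
    case True
    \<comment> \<open>Even indices for \<open>x\<close> and odd ones for \<open>z\<close> avoid the
      diagonal, so \<open>i \<le> j\<close> becomes the strict \<open>2 * i < 2 * j + 1\<close>.
      There the colour gives truth for \<open>y\<close>, and \<open>above\<close> carries it over to
      \<open>z\<close>.\<close>
    have "R (x (k (2 * i))) (z (k (2 * j + 1))) \<longleftrightarrow> i \<le> j" for i j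
    proof (cases "i \<le> j")
      case True
      then have "2 * i < 2 * j + 1" by simp
      then show ?thesis using True col[of "2*i" "2*j+1"] \<open>t = 1\<close> above k(2) by metis
    next
      case False
      then have "2 * j + 1 < 2 * i" by simp
      then show ?thesis using False below(2) k(2) by metis
    qed
    then show False
      using half_graph_free_le[OF free, of "\<lambda>i. x (k (2 * i))" "\<lambda>j. z (k (2 * j + 1))"] rng by blast
  next
    case False
    \<comment> \<open>Mirror case: the relation fails for a smaller index on \<open>x\<close>, and
      the \<open>y\<close> give the reversed half graph.\<close>
    have "R (x (k (2 * i + 1))) (y (k (2 * j))) \<longleftrightarrow> j \<le> i" for i j
    proof (cases "j \<le> i")
      case True
      then have "2 * j < 2 * i + 1" by simp
      then show ?thesis using True below(1) k(2) by metis
    next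
      case ji: False
      then have "2 * i + 1 < 2 * j" by simp
      then show ?thesis using ji col[of "2*i+1" "2*j"] \<open>t \<noteq> 1\<close> by metis
    qed
    then show False
      using half_graph_free_ge[OF free, of "\<lambda>i. x (k (2 * i + 1))" "\<lambda>j. y (k (2 * j))"] rng by blast
  qed
qed

text \<open>By Tychonoff the space of predicates on \<open>'y\<close> is compact, so the sequence
  has a cluster point, whose set of true arguments is \<open>D\<close>. The finite sets
  \<open>Z\<close> describe its basic neighbourhoods.\<close>

lemma cluster_trace:
  fixes \<rho> :: "nat \<Rightarrow> 'y \<Rightarrow> bool"
  shows "\<exists>D. \<forall>Z m. finite Z \<longrightarrow> (\<exists>n\<ge>m. \<forall>y\<in>Z. \<rho> n y \<longleftrightarrow> y \<in> D)"
proof -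
  have "compactin (product_topology (\<lambda>_. euclidean) UNIV) (PiE UNIV (\<lambda>_ :: 'y. UNIV :: bool set))"
    unfolding compactin_PiE by (simp add: finite_imp_compact)
  then have "compact (UNIV :: ('y \<Rightarrow> bool) set)"
    by (simp add: euclidean_product_topology)
  moreover have "filtermap \<rho> sequentially \<noteq> bot"
    by (simp add: filtermap_bot_iff)
  moreover have "eventually (\<lambda>x. x \<in> UNIV) (filtermap \<rho> sequentially)" by simp
  ultimately obtain d where d: "inf (nhds d) (filtermap \<rho> sequentially) \<noteq> bot"
    unfolding compact_filter by blast
  have "\<exists>n\<ge>m. \<forall>y\<in>Z. \<rho> n y \<longleftrightarrow> d y" if "finite Z" for Z m
  proof (rule ccontr)
    assume none: "\<not> ?thesis"
    have "{f. \<forall>y\<in>Z. f y \<in> {d y}} = PiE UNIV (\<lambda>y. if y \<in> Z then {d y} else UNIV)"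
      by (auto simp: PiE_def Pi_def split: if_splits)
    moreover have "open \<dots>"
      using that by (intro open_PiE) (auto simp: open_discrete intro: rev_finite_subset)
    ultimately have "eventually (\<lambda>f. \<forall>y\<in>Z. f y = d y) (nhds d)"
      unfolding eventually_nhds by (intro exI[of _ "{f. \<forall>y\<in>Z. f y \<in> {d y}}"]) auto
    moreover have "eventually (\<lambda>f. \<not> (\<forall>y\<in>Z. f y = d y)) (filtermap \<rho> sequentially)"
      unfolding eventually_filtermap eventually_sequentially using none by blast
    ultimately have "eventually (\<lambda>f. False) (inf (nhds d) (filtermap \<rho> sequentially))"
      unfolding eventually_inf by blast
    then show False using d by (simp add: eventually_False)
  qed
  then show ?thesis by (intro exI[of _ "Collect d"]) auto
qed

lemma uncountable_bool_sequences: "uncountable (UNIV :: (nat \<Rightarrow> bool) set)"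
proof
  assume "countable (UNIV :: (nat \<Rightarrow> bool) set)"
  then obtain g :: "nat \<Rightarrow> nat \<Rightarrow> bool" where "surj g"
    by (metis UNIV_not_empty range_from_nat_into)
  then obtain n where "g n = (\<lambda>k. \<not> g k k)" by (metis surjD)
  then show False by (metis (mono_tags))
qed

text \<open>Otherwise every member of \<open>\<L>\<close> splits into two members, which gives a
  full binary tree. Points along each of its uncountably many branches cluster to a different set,
  whereas \<open>definability\<close> over a countable set of points allows only countably many
  limits.\<close>

lemma unsplit_set_exists:
  assumes free: "half_graph_free R X Y"
    and sub: "\<And>L. L \<in> \<L> \<Longrightarrow> L \<subseteq> X" and ne: "\<L> \<noteq> {}" "{} \<notin> \<L>"
  shows "\<exists>L\<in>\<L>. \<forall>y\<in>Y. {x \<in> L. R x y} \<notin> \<L> \<or> {x \<in> L. \<not> R x y} \<notin> \<L>"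
proof (rule ccontr)
  assume "\<not> ?thesis"
  then have "\<forall>L\<in>\<L>. \<exists>y. y \<in> Y \<and> {x \<in> L. R x y} \<in> \<L> \<and> {x \<in> L. \<not> R x y} \<in> \<L>"
    by simp blast
  from bchoice[OF this] obtain w
    where w: "\<And>L. L \<in> \<L> \<Longrightarrow> w L \<in> Y \<and> {x \<in> L. R x (w L)} \<in> \<L> \<and> {x \<in> L. \<not> R x (w L)} \<in> \<L>"
    by blast
  obtain L0 where L0: "L0 \<in> \<L>" using ne(1) by (auto simp del: ne)
  \<comment> \<open>A node of the tree is a list of turns with the latest turn at its head; the turn
    \<open>True\<close> goes to the side where \<open>R x (w L)\<close> holds.\<close>
  define T where "T = rec_list L0 (\<lambda>b _ L. {x \<in> L. R x (w L) \<longleftrightarrow> b})"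
  have T_simps: "T [] = L0" "T (b # s) = {x \<in> T s. R x (w (T s)) \<longleftrightarrow> b}" for b s
    by (simp_all add: T_def)
  have TL: "T s \<in> \<L>" for s
  proof (induction s)
    case (Cons b s)
    then show ?case using w[of "T s"] by (cases b) (simp_all add: T_simps)
  qed (simp add: T_simps L0)
  have T_app: "T (r @ s) \<subseteq> T s" for r s
    by (induction r) (auto simp: T_simps)
  define p where "p s = (SOME x. x \<in> T s)" for s
  have p: "p s \<in> T s" for s
    using TL[of s] ne(2) unfolding p_def by (metis some_in_eq)
  \<comment> \<open>Restricting to the points and splitting elements of the tree makes the set of
    points countable.\<close>
  define X0 Y0 where "X0 = range p" and "Y0 = range (\<lambda>s. w (T s))"
  have sub0: "X0 \<subseteq> X" "Y0 \<subseteq> Y"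
    using p sub TL w by (auto simp: X0_def Y0_def)
  have free0: "half_graph_free R X0 Y0"
    using half_graph_free_mono[OF free sub0] .
  have ctbl: "countable X0" by (simp add: X0_def)
  define br where "br \<eta> n = rev (map \<eta> [0..<n])" for \<eta> :: "nat \<Rightarrow> bool" and n
  have br: "R (p (br \<eta> n)) (w (T (br \<eta> m))) \<longleftrightarrow> \<eta> m" if "m < n" for \<eta> m n
  proof -
    have "\<exists>r. br \<eta> n = r @ \<eta> m # br \<eta> m"
    proof -
      have "[0..<n] = [0..<m] @ m # [Suc m..<n]"
        using that by (metis less_imp_add_positive upt_add_eq_append upt_conv_Cons zero_le le_add1)
      then show ?thesis by (simp add: br_def)
    qed
    then have "p (br \<eta> n) \<in> T (\<eta> m # br \<eta> m)" using p T_app by (metis subsetD)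
    then show ?thesis by (simp add: T_simps)
  qed
  have "\<exists>D. \<forall>Z m. finite Z \<longrightarrow> (\<exists>n\<ge>m. \<forall>y\<in>Z. R (p (br \<eta> n)) y \<longleftrightarrow> y \<in> D)" for \<eta>
    by (rule cluster_trace)
  then obtain D where D: "\<And>\<eta> Z m. finite Z \<Longrightarrow> \<exists>n\<ge>m. \<forall>y\<in>Z. R (p (br \<eta> n)) y \<longleftrightarrow> y \<in> D \<eta>"
    by metis
  \<comment> \<open>Points far down the branch all lie on the side chosen at level \<open>m\<close>,
    so their limit still shows that turn.\<close>
  have D_br: "w (T (br \<eta> m)) \<in> D \<eta> \<longleftrightarrow> \<eta> m" for \<eta> m
  proof -
    obtain n where "n \<ge> Suc m" "R (p (br \<eta> n)) (w (T (br \<eta> m))) \<longleftrightarrow> w (T (br \<eta> m)) \<in> D \<eta>"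
      using D[of "{w (T (br \<eta> m))}" "Suc m" \<eta>] by auto
    then show ?thesis using br[of m n \<eta>] by simp
  qed
  have appr: "\<exists>x\<in>X0. \<forall>y\<in>Z. R x y \<longleftrightarrow> y \<in> D \<eta>" if "finite Z" for \<eta> Z
    using D[OF that, of 0 \<eta>] by (auto simp: X0_def)
  have "\<exists>F. finite F \<and> F \<subseteq> X0 \<and>
      (\<forall>y\<in>Y0. \<forall>z\<in>Y0. (\<forall>x\<in>F. R x y \<longleftrightarrow> R x z) \<longrightarrow> (y \<in> D \<eta> \<longleftrightarrow> z \<in> D \<eta>))" for \<eta>
    by (rule definability[OF free0 appr])
  then obtain F where F: "\<And>\<eta>. finite (F \<eta>)" "\<And>\<eta>. F \<eta> \<subseteq> X0"
      "\<And>\<eta> y z. y \<in> Y0 \<Longrightarrow> z \<in> Y0 \<Longrightarrow> (\<forall>x\<in>F \<eta>. R x y \<longleftrightarrow> R x z) \<Longrightarrow> y \<in> D \<eta> \<longleftrightarrow> z \<in> D \<eta>"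
    by metis
  \<comment> \<open>On \<open>Y0\<close>, the limit \<open>D \<eta>\<close> is determined by the
    finite set \<open>F \<eta>\<close> and by the traces on it of the members of
    \<open>D \<eta>\<close>; such data form a countable set.\<close>
  define code where "code \<eta> = (F \<eta>, (\<lambda>y. {x \<in> F \<eta>. R x y}) ` (Y0 \<inter> D \<eta>))" for \<eta>
  have "inj code"
  proof (rule injI)
    fix \<eta> \<theta> assume eq: "code \<eta> = code \<theta>"
    have sub: "Y0 \<inter> D \<eta> \<subseteq> D \<theta>" if "code \<eta> = code \<theta>" for \<eta> \<theta>
    proof
      fix y assume y: "y \<in> Y0 \<inter> D \<eta>"
      then have "{x \<in> F \<theta>. R x y} \<in> (\<lambda>y. {x \<in> F \<theta>. R x y}) ` (Y0 \<inter> D \<theta>)"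
      proof -
        have "F \<eta> = F \<theta> \<and> (\<lambda>y. {x \<in> F \<eta>. R x y}) ` (Y0 \<inter> D \<eta>) = (\<lambda>y. {x \<in> F \<theta>. R x y}) ` (Y0 \<inter> D \<theta>)"
          using that unfolding code_def prod.inject .
        then show ?thesis using imageI[OF y, of "\<lambda>y. {x \<in> F \<eta>. R x y}"] by metis
      qed
      then obtain z where z: "z \<in> Y0 \<inter> D \<theta>" "{x \<in> F \<theta>. R x y} = {x \<in> F \<theta>. R x z}"
        by (rule imageE) simp
      from z(2) have "\<forall>x\<in>F \<theta>. R x y \<longleftrightarrow> R x z" by blast
      then show "y \<in> D \<theta>" using F(3)[of y z \<theta>] y z(1) by simp
    qed
    have agree: "y \<in> D \<eta> \<longleftrightarrow> y \<in> D \<theta>" if "y \<in> Y0" for y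
      using sub[OF eq] sub[OF eq[symmetric]] that by blast
    \<comment> \<open>Equal earlier turns lead to the same node, and its splitting element reveals
      the next turn.\<close>
    have "\<eta> n = \<theta> n" for n
    proof (induction n rule: less_induct)
      case (less n)
      then have "br \<eta> n = br \<theta> n" by (simp add: br_def)
      moreover have "w (T (br \<eta> n)) \<in> Y0" by (simp add: Y0_def)
      ultimately show ?case using agree D_br by metis
    qed
    then show "\<eta> = \<theta>" by blast
  qed
  moreover have "countable (range code)"
  proof (rule countable_subset)
    show "range code \<subseteq> (SIGMA K : {K. finite K \<and> K \<subseteq> X0}. Pow (Pow K))"
      using F by (auto simp: code_def)
    show "countable (SIGMA K : {K. finite K \<and> K \<subseteq> X0}. Pow (Pow K))"
      using ctbl by (intro countable_SIGMA countable_Collect_finite_subset) (auto intro: countable_finite)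
  qed
  ultimately show False
    using uncountable_bool_sequences countable_image_inj_eq by metis
qed

section \<open>Maximal invariant ideals\<close>

lemma finite_image_factor:
  assumes "finite (\<phi> ` X)" and "\<And>x y. x \<in> X \<Longrightarrow> y \<in> X \<Longrightarrow> \<phi> x = \<phi> y \<Longrightarrow> \<psi> x = \<psi> y"
  shows "finite (\<psi> ` X)"
proof -
  have "\<psi> x = \<psi> (inv_into X \<phi> (\<phi> x))" if "x \<in> X" for x
    using assms(2)[OF that inv_into_into[of "\<phi> x" \<phi> X]] that by (simp add: f_inv_into_f)
  then have "\<psi> ` X \<subseteq> (\<lambda>z. \<psi> (inv_into X \<phi> z)) ` \<phi> ` X" by blast
  then show ?thesis using assms(1) by (meson finite_imageI finite_subset)
qed

section \<open>Translates, inverses and stability in a group\<close>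

context group
begin

lemma sym_diff_l_coset: "sym_diff (g <# X) (g <# Y) \<subseteq> g <# sym_diff X Y"
  unfolding l_coset_def by blast

lemma mem_l_coset_iff:
  assumes "g \<in> carrier G" "X \<subseteq> carrier G"
  shows "x \<in> g <# X \<longleftrightarrow> x \<in> carrier G \<and> inv g \<otimes> x \<in> X"
proof
  assume "x \<in> g <# X"
  then obtain y where "y \<in> X" "x = g \<otimes> y" by (auto simp: l_coset_def)
  then show "x \<in> carrier G \<and> inv g \<otimes> x \<in> X" using assms by (auto simp: m_assoc[symmetric])
next
  assume x: "x \<in> carrier G \<and> inv g \<otimes> x \<in> X"
  then have "x = g \<otimes> (inv g \<otimes> x)" using assms by (simp add: m_assoc[symmetric])
  then show "x \<in> g <# X" using x by (auto simp: l_coset_def)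
qed

lemma mult_mem_l_coset_iff:
  assumes "g \<in> carrier G" "h \<in> carrier G" "x \<in> carrier G" "X \<subseteq> carrier G"
  shows "h \<otimes> x \<in> g <# X \<longleftrightarrow> x \<in> (inv h \<otimes> g) <# X"
  using assms by (simp add: mem_l_coset_iff inv_mult_group m_assoc)

lemma mem_r_coset_iff:
  assumes "g \<in> carrier G" "X \<subseteq> carrier G"
  shows "x \<in> X #> g \<longleftrightarrow> x \<in> carrier G \<and> x \<otimes> inv g \<in> X"
proof
  assume "x \<in> X #> g"
  then obtain y where "y \<in> X" "x = y \<otimes> g" by (auto simp: r_coset_def)
  then show "x \<in> carrier G \<and> x \<otimes> inv g \<in> X" using assms by (auto simp: m_assoc)
next
  assume x: "x \<in> carrier G \<and> x \<otimes> inv g \<in> X"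
  then have "x = (x \<otimes> inv g) \<otimes> g" using assms by (simp add: m_assoc)
  then show "x \<in> X #> g" using x by (auto simp: r_coset_def)
qed

lemma mem_set_inv_iff:
  assumes "X \<subseteq> carrier G"
  shows "x \<in> set_inv X \<longleftrightarrow> x \<in> carrier G \<and> inv x \<in> X"
proof
  assume "x \<in> set_inv X"
  then show "x \<in> carrier G \<and> inv x \<in> X" using assms by (auto simp: SET_INV_def subset_iff)
next
  assume x: "x \<in> carrier G \<and> inv x \<in> X"
  then have "inv (inv x) \<in> set_inv X" unfolding SET_INV_def by blast
  then show "x \<in> set_inv X" using x by simp
qed

lemma set_inv_subset: "X \<subseteq> carrier G \<Longrightarrow> set_inv X \<subseteq> carrier G"
  by (auto simp: SET_INV_def)

lemma set_inv_set_inv: "X \<subseteq> carrier G \<Longrightarrow> set_inv (set_inv X) = X"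
  by (auto simp: mem_set_inv_iff set_inv_subset subset_iff)

lemma set_mult_UN: "F <#> X = (\<Union>f\<in>F. f <# X)"
  by (auto simp: set_mult_def l_coset_def)

lemma stable_half_graph_free:
  assumes "stable_in G A"
  shows "half_graph_free (\<lambda>x y. x \<otimes> y \<in> A) (carrier G) (carrier G)"
proof -
  have 1: "linear_order_on UNIV {(i, j :: nat). i \<le> j}"
    by (auto simp: order_on_defs refl_on_def trans_def antisym_def total_on_def)
  have 2: "linear_order_on UNIV {(i, j :: nat). j \<le> i}"
    by (auto simp: order_on_defs refl_on_def trans_def antisym_def total_on_def)
  have "\<not> (\<forall>i j. a i \<otimes> b j \<in> A \<longleftrightarrow> i \<le> j)" "\<not> (\<forall>i j. a i \<otimes> b j \<in> A \<longleftrightarrow> j \<le> i)"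
    if "range a \<subseteq> carrier G" "range b \<subseteq> carrier G" for a b :: "nat \<Rightarrow> 'a"
  proof -
    have "a \<in> UNIV \<rightarrow> carrier G" "b \<in> UNIV \<rightarrow> carrier G" using that by auto
    then show "\<not> (\<forall>i j. a i \<otimes> b j \<in> A \<longleftrightarrow> i \<le> j)" "\<not> (\<forall>i j. a i \<otimes> b j \<in> A \<longleftrightarrow> j \<le> i)"
      using stable_in_any_index[OF assms infinite_UNIV_nat 1, of a b]
        stable_in_any_index[OF assms infinite_UNIV_nat 2, of a b] by simp_all
  qed
  then show ?thesis by (rule half_graph_freeI)
qed

text \<open>Since \<open>x \<in> g <# A\<close> means \<open>inv g \<otimes> x \<in> A\<close>, the
  two variables change places; each orientation is therefore refuted by the opposite one.\<close>

lemma stable_translates_half_graph_free: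
  assumes "stable_in G A" "A \<subseteq> carrier G"
  shows "half_graph_free (\<lambda>x g. x \<in> g <# A) (carrier G) (carrier G)"
proof -
  have *: "a i \<in> b j <# A \<longleftrightarrow> inv (b j) \<otimes> a i \<in> A"
    if "range a \<subseteq> carrier G" "range b \<subseteq> carrier G" for a b :: "nat \<Rightarrow> 'a" and i j
    using that assms(2) by (auto simp: mem_l_coset_iff image_subset_iff)
  have rng: "range (\<lambda>j. inv (b j)) \<subseteq> carrier G" if "range b \<subseteq> carrier G" for b :: "nat \<Rightarrow> 'a"
    using that by auto
  note free = stable_half_graph_free[OF assms(1)]
  have "\<not> (\<forall>i j. a i \<in> b j <# A \<longleftrightarrow> i \<le> j)" "\<not> (\<forall>i j. a i \<in> b j <# A \<longleftrightarrow> j \<le> i)"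
    if ab: "range a \<subseteq> carrier G" "range b \<subseteq> carrier G" for a b :: "nat \<Rightarrow> 'a"
  proof -
    show "\<not> (\<forall>i j. a i \<in> b j <# A \<longleftrightarrow> i \<le> j)"
      using half_graph_free_ge[OF free rng[OF ab(2)] ab(1)] unfolding *[OF ab] by blast
    show "\<not> (\<forall>i j. a i \<in> b j <# A \<longleftrightarrow> j \<le> i)"
      using half_graph_free_le[OF free rng[OF ab(2)] ab(1)] unfolding *[OF ab] by blast
  qed
  then show ?thesis by (rule half_graph_freeI)
qed

text \<open>Inversion reverses products, so a configuration for the inverse set over
  \<open>r\<close> becomes one for \<open>A\<close> over the converse order.\<close>

lemma stable_set_inv:
  assumes "stable_in G A" "A \<subseteq> carrier G"
  shows "stable_in G (set_inv A)"
  unfolding stable_in_def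
proof clarify
  fix I :: "'a set" and r a b
  assume I: "infinite I" "linear_order_on I r" and ab: "a \<in> I \<rightarrow> carrier G" "b \<in> I \<rightarrow> carrier G"
    and R: "\<forall>i\<in>I. \<forall>j\<in>I. (a i \<otimes> b j \<in> set_inv A) = ((i, j) \<in> r)"
  have "inv (b i) \<otimes> inv (a j) \<in> A \<longleftrightarrow> (i, j) \<in> r\<inverse>" if "i \<in> I" "j \<in> I" for i j
    using R ab that assms(2) by (auto simp: mem_set_inv_iff inv_mult_group[symmetric] Pi_iff)
  moreover have "linear_order_on I (r\<inverse>)" using I(2) by simp
  ultimately show False
    using stable_in_any_index[OF assms(1) I(1), of "r\<inverse>" "\<lambda>i. inv (b i)" "\<lambda>i. inv (a i)"] ab
    by (auto simp: Pi_iff)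
qed

lemma stable_r_coset:
  assumes "stable_in G A" "A \<subseteq> carrier G" "g \<in> carrier G"
  shows "stable_in G (A #> g)"
  unfolding stable_in_def
proof clarify
  fix I :: "'a set" and r a b
  assume I: "infinite I" "linear_order_on I r" and ab: "a \<in> I \<rightarrow> carrier G" "b \<in> I \<rightarrow> carrier G"
    and R: "\<forall>i\<in>I. \<forall>j\<in>I. (a i \<otimes> b j \<in> A #> g) = ((i, j) \<in> r)"
  have "a i \<otimes> (b j \<otimes> inv g) \<in> A \<longleftrightarrow> (i, j) \<in> r" if "i \<in> I" "j \<in> I" for i j
    using R[rule_format, OF that] ab that assms(2,3) by (auto simp: mem_r_coset_iff m_assoc Pi_iff)
  then show False
    using stable_in_any_index[OF assms(1) I, of a "\<lambda>i. b i \<otimes> inv g"] ab assms(3)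
    by (auto simp: Pi_iff)
qed

text \<open>For a left coset it is \<open>inv y \<otimes> x\<close> that lies in \<open>N\<close>
  automatically; the quotient in this form needs normality. It identifies which left translations
  map a point of \<open>C\<close> into \<open>C\<close>.\<close>

lemma normal_l_coset_quotient:
  assumes "N \<lhd> G" "C \<in> lcosets N" "x \<in> C" "y \<in> C"
  shows "x \<otimes> inv y \<in> N"
proof -
  interpret N: normal N G by fact
  obtain g where g: "g \<in> carrier G" "C = g <# N" using assms(2) by (auto simp: LCOSETS_def)
  then obtain m n where mn: "m \<in> N" "n \<in> N" "x = g \<otimes> m" "y = g \<otimes> n"
    using assms by (auto simp: l_coset_def)
  then have "x \<otimes> inv y = g \<otimes> (m \<otimes> inv n) \<otimes> inv g"
    using g by (simp add: inv_mult_group m_assoc)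
  then show ?thesis using mn g by (simp add: N.inv_op_closed2)
qed

text \<open>For a subgroup \<open>N\<close> these are the unions of left cosets of \<open>N\<close>.
  Closure under right multiplication makes the passage to a smaller subgroup immediate.\<close>

definition periodic :: "'a set \<Rightarrow> 'a set \<Rightarrow> bool" where
  "periodic N Y \<longleftrightarrow> Y \<subseteq> carrier G \<and> (\<forall>y\<in>Y. \<forall>n\<in>N. y \<otimes> n \<in> Y)"

text \<open>The ideals live on the whole power set and not on \<open>\<B>\<close>, so that inverses,
  right translates and periodic sets outside \<open>\<B>\<close> can be tested as well.\<close>

definition invariant_ideal :: "'a set set \<Rightarrow> bool" where
  "invariant_ideal \<I> \<longleftrightarrow> \<I> \<subseteq> Pow (carrier G) \<and> {} \<in> \<I> \<and> carrier G \<notin> \<I> \<and>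
     (\<forall>X\<in>\<I>. \<forall>Y\<in>\<I>. X \<union> Y \<in> \<I>) \<and> (\<forall>X\<in>\<I>. \<forall>Y\<subseteq>X. Y \<in> \<I>) \<and>
     (\<forall>g\<in>carrier G. \<forall>X\<in>\<I>. g <# X \<in> \<I>)"

end

section \<open>Maximal invariant ideals and their existence\<close>

locale maximal_ideal = group G for G (structure) +
  fixes \<I> :: "'a set set"
  assumes invariant: "invariant_ideal \<I>"
    and cover: "X \<subseteq> carrier G \<Longrightarrow> X \<notin> \<I> \<Longrightarrow>
      \<exists>F S. finite F \<and> F \<subseteq> carrier G \<and> S \<in> \<I> \<and> carrier G = (F <#> X) \<union> S"

text \<open>Zorn's lemma for the proper invariant ideals that contain \<open>A\<close>.
  Non-genericity of \<open>A\<close> says exactly that its translates generate a proper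
  ideal.\<close>

lemma (in group) maximal_ideal_exists:
  assumes A: "A \<subseteq> carrier G" "\<not> generic_in G A"
  shows "\<exists>\<I>. maximal_ideal G \<I> \<and> A \<in> \<I>"
proof -
  \<comment> \<open>\<open>ext M X\<close> is the invariant ideal generated by \<open>M\<close> and
    \<open>X\<close>.\<close>
  define ext where "ext M X = {Z. \<exists>F S. finite F \<and> F \<subseteq> carrier G \<and> S \<in> M \<and> Z \<subseteq> (F <#> X) \<union> S}" for M X
  have ext_ideal: "invariant_ideal (ext M X)"
    if M: "M \<subseteq> Pow (carrier G)" "{} \<in> M" "\<And>X Y. X \<in> M \<Longrightarrow> Y \<in> M \<Longrightarrow> X \<union> Y \<in> M"
        "\<And>g X. g \<in> carrier G \<Longrightarrow> X \<in> M \<Longrightarrow> g <# X \<in> M"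
      and X: "X \<subseteq> carrier G" "carrier G \<notin> ext M X" for M X
    unfolding invariant_ideal_def
  proof (intro conjI ballI allI impI)
    show "ext M X \<subseteq> Pow (carrier G)"
      using M(1) X(1) set_mult_closed unfolding ext_def by blast
    show "{} \<in> ext M X" unfolding ext_def using M(2) by blast
    show "carrier G \<notin> ext M X" by fact
    show "P \<union> Q \<in> ext M X" if "P \<in> ext M X" "Q \<in> ext M X" for P Q
    proof -
      obtain F S where "finite F" "F \<subseteq> carrier G" "S \<in> M" "P \<subseteq> (F <#> X) \<union> S"
        using \<open>P \<in> ext M X\<close> by (auto simp: ext_def)
      moreover obtain F' S' where "finite F'" "F' \<subseteq> carrier G" "S' \<in> M" "Q \<subseteq> (F' <#> X) \<union> S'"
        using \<open>Q \<in> ext M X\<close> by (auto simp: ext_def)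
      ultimately show ?thesis
        unfolding ext_def mem_Collect_eq
        by (intro exI[of _ "F \<union> F'"] exI[of _ "S \<union> S'"]) (auto simp: set_mult_UN intro: M(3))
    qed
    show "Q \<in> ext M X" if "P \<in> ext M X" "Q \<subseteq> P" for P Q
      using that unfolding ext_def by (blast intro: order_trans)
    show "g <# P \<in> ext M X" if g: "g \<in> carrier G" and "P \<in> ext M X" for g P
    proof -
      obtain F S where FS: "finite F" "F \<subseteq> carrier G" "S \<in> M" "P \<subseteq> (F <#> X) \<union> S"
        using \<open>P \<in> ext M X\<close> by (auto simp: ext_def)
      have "g <# P \<subseteq> g <# ((F <#> X) \<union> S)" using FS(4) by (auto simp: l_coset_def)
      also have "\<dots> = (g <# (F <#> X)) \<union> (g <# S)" by (auto simp: l_coset_def)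
      also have "g <# (F <#> X) = (g <# F) <#> X" using FS(2) g X(1) by (simp add: setmult_lcos_assoc)
      finally have "g <# P \<subseteq> ((g <# F) <#> X) \<union> (g <# S)" .
      moreover have "finite (g <# F)" "g <# F \<subseteq> carrier G"
        using FS g by (auto simp: l_coset_def)
      ultimately show ?thesis unfolding ext_def using M(4)[OF g FS(3)] by blast
    qed
  qed
  have ext_self: "X \<in> ext M X" if "{} \<in> M" "X \<subseteq> carrier G" for M X
    unfolding ext_def mem_Collect_eq using that
    by (intro exI[where x = "{\<one>}"] exI[where x = "{}"])
      (simp add: set_mult_UN lcos_mult_one)
  have ext_sub: "M \<subseteq> ext M X" for M X
    unfolding ext_def by (force simp: set_mult_def)
  define \<S> where "\<S> = {\<I>. invariant_ideal \<I> \<and> A \<in> \<I>}"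
  have "carrier G \<notin> ext {{}} A"
  proof
    assume "carrier G \<in> ext {{}} A"
    then obtain F where "finite F" "F \<subseteq> carrier G" "carrier G \<subseteq> F <#> A" by (auto simp: ext_def)
    then show False using A set_mult_closed[of F A] unfolding generic_in_def by blast
  qed
  then have "invariant_ideal (ext {{}} A)"
    using A by (intro ext_ideal) (auto simp: l_coset_def)
  then have "\<S> \<noteq> {}" using ext_self[of "{{}}" A] A by (auto simp: \<S>_def)
  moreover have "\<Union>\<C> \<in> \<S>" if "\<C> \<noteq> {}" and ch: "subset.chain \<S> \<C>" for \<C>
  proof -
    have id: "invariant_ideal M" "A \<in> M" if "M \<in> \<C>" for M
      using ch that by (auto simp: subset.chain_def \<S>_def)
    have un: "P \<union> Q \<in> \<Union>\<C>" if PQ: "P \<in> \<Union>\<C>" "Q \<in> \<Union>\<C>" for P Q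
    proof -
      obtain M M' where "M \<in> \<C>" "P \<in> M" "M' \<in> \<C>" "Q \<in> M'" using PQ by blast
      moreover then have "M \<subseteq> M' \<or> M' \<subseteq> M" using ch by (auto simp: subset_chain_def)
      ultimately obtain M where M: "M \<in> \<C>" "P \<in> M" "Q \<in> M" by blast
      have "\<forall>X\<in>M. \<forall>Y\<in>M. X \<union> Y \<in> M" using id(1)[OF M(1)] by (simp add: invariant_ideal_def)
      then show ?thesis using M by blast
    qed
    have "invariant_ideal (\<Union>\<C>)"
      unfolding invariant_ideal_def
    proof (intro conjI ballI allI impI)
      show "\<Union>\<C> \<subseteq> Pow (carrier G)" "carrier G \<notin> \<Union>\<C>"
        using id(1) unfolding invariant_ideal_def by blast+
      show "{} \<in> \<Union>\<C>" using id(1) \<open>\<C> \<noteq> {}\<close> unfolding invariant_ideal_def by blast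
      show "P \<union> Q \<in> \<Union>\<C>" if "P \<in> \<Union>\<C>" "Q \<in> \<Union>\<C>" for P Q by (rule un[OF that])
      show "Q \<in> \<Union>\<C>" if "P \<in> \<Union>\<C>" "Q \<subseteq> P" for P Q
        using that id(1) unfolding invariant_ideal_def by blast
      show "g <# P \<in> \<Union>\<C>" if "g \<in> carrier G" "P \<in> \<Union>\<C>" for g P
        using that id(1) unfolding invariant_ideal_def by blast
    qed
    then show ?thesis using id(2) \<open>\<C> \<noteq> {}\<close> by (auto simp: \<S>_def)
  qed
  ultimately obtain M where M: "M \<in> \<S>" "\<And>J. J \<in> \<S> \<Longrightarrow> M \<subseteq> J \<Longrightarrow> J = M"
    using subset_Zorn_nonempty[of \<S>] by metis
  then have inv: "invariant_ideal M" and "A \<in> M" by (auto simp: \<S>_def)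
  have "maximal_ideal G M"
  proof (unfold_locales, fact inv)
    fix X assume X: "X \<subseteq> carrier G" "X \<notin> M"
    \<comment> \<open>If adjoining \<open>X\<close> kept the ideal proper, maximality would put
      \<open>X\<close> into \<open>M\<close>. Improperness of the extension is the required covering
      property.\<close>
    have "carrier G \<in> ext M X"
    proof (rule ccontr)
      assume "carrier G \<notin> ext M X"
      then have "invariant_ideal (ext M X)"
        using inv X(1) by (intro ext_ideal) (simp_all add: invariant_ideal_def)
      then have "ext M X = M"
        using M(2) ext_sub[of M X] \<open>A \<in> M\<close> by (auto simp: \<S>_def)
      then show False using ext_self[of M X] X inv by (auto simp: invariant_ideal_def)
    qed
    then obtain F S where FS: "finite F" "F \<subseteq> carrier G" "S \<in> M" "carrier G \<subseteq> (F <#> X) \<union> S"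
      by (auto simp: ext_def)
    moreover have "(F <#> X) \<union> S \<subseteq> carrier G"
      using FS X inv set_mult_closed[of F X] by (auto simp: invariant_ideal_def)
    ultimately show "\<exists>F S. finite F \<and> F \<subseteq> carrier G \<and> S \<in> M \<and> carrier G = (F <#> X) \<union> S" by blast
  qed
  then show ?thesis using \<open>A \<in> M\<close> by blast
qed

section \<open>Stable sets modulo a maximal ideal\<close>

context maximal_ideal
begin

lemma empty_small: "{} \<in> \<I>"
  and carrier_not_small: "carrier G \<notin> \<I>"
  and Un_small: "X \<in> \<I> \<Longrightarrow> Y \<in> \<I> \<Longrightarrow> X \<union> Y \<in> \<I>"
  and subset_small: "X \<in> \<I> \<Longrightarrow> Y \<subseteq> X \<Longrightarrow> Y \<in> \<I>"
  and l_coset_small: "g \<in> carrier G \<Longrightarrow> X \<in> \<I> \<Longrightarrow> g <# X \<in> \<I>"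
  using invariant unfolding invariant_ideal_def by blast+

lemma UN_small: "finite F \<Longrightarrow> (\<And>f. f \<in> F \<Longrightarrow> E f \<in> \<I>) \<Longrightarrow> (\<Union>f\<in>F. E f) \<in> \<I>"
  by (induction F rule: finite_induct) (auto intro: empty_small Un_small)

text \<open>Some large set \<open>U\<close> is split by no translate of \<open>A\<close>, and
  finitely many translates \<open>f <# U\<close> cover the group up to a small set. On
  \<open>f <# U\<close> each translate of \<open>A\<close> is almost everything or almost nothing,
  so its class is fixed by finitely many bits.\<close>

lemma finite_translate_classes:
  assumes st: "stable_in G A" and A: "A \<subseteq> carrier G"
  shows "\<exists>K. finite K \<and> K \<subseteq> carrier G \<and> (\<forall>g\<in>carrier G. \<exists>k\<in>K. sym_diff (g <# A) (k <# A) \<in> \<I>)"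
proof -
  let ?L = "{L. L \<subseteq> carrier G \<and> L \<notin> \<I>}"
  have "\<exists>L\<in>?L. \<forall>g\<in>carrier G. {x \<in> L. x \<in> g <# A} \<notin> ?L \<or> {x \<in> L. x \<notin> g <# A} \<notin> ?L"
    by (rule unsplit_set_exists[OF stable_translates_half_graph_free[OF st A]])
      (use carrier_not_small empty_small in auto)
  then obtain U where U: "U \<subseteq> carrier G" "U \<notin> \<I>"
    and unsplit: "\<And>g. g \<in> carrier G \<Longrightarrow> {x \<in> U. x \<in> g <# A} \<in> \<I> \<or> {x \<in> U. x \<notin> g <# A} \<in> \<I>"
    by blast
  obtain F S where F: "finite F" "F \<subseteq> carrier G" and S: "S \<in> \<I>" "carrier G = (F <#> U) \<union> S"
    using cover[OF U] by blast
  \<comment> \<open>The bits: those \<open>f\<close> for which \<open>g <# A\<close> contains almost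
    all of \<open>f <# U\<close>, pulled back to \<open>U\<close> by \<open>inv f\<close>.\<close>
  define c where "c g = {f \<in> F. {x \<in> U. x \<notin> (inv f \<otimes> g) <# A} \<in> \<I>}" for g
  have c_eq: "sym_diff (g <# A) (h <# A) \<in> \<I>"
    if g: "g \<in> carrier G" and h: "h \<in> carrier G" and eq: "c g = c h" for g h
  proof -
    define E where "E f = {x \<in> U. (x \<in> (inv f \<otimes> g) <# A) \<noteq> (x \<in> (inv f \<otimes> h) <# A)}" for f
    have "E f \<in> \<I>" if f: "f \<in> F" for f
    proof (cases "f \<in> c g")
      case True
      then have "{x \<in> U. x \<notin> (inv f \<otimes> g) <# A} \<union> {x \<in> U. x \<notin> (inv f \<otimes> h) <# A} \<in> \<I>"
        using eq by (intro Un_small) (auto simp: c_def)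
      then show ?thesis by (rule subset_small) (auto simp: E_def)
    next
      case False
      then have "{x \<in> U. x \<in> (inv f \<otimes> g) <# A} \<in> \<I>" "{x \<in> U. x \<in> (inv f \<otimes> h) <# A} \<in> \<I>"
        using unsplit[of "inv f \<otimes> g"] unsplit[of "inv f \<otimes> h"] f F(2) g h eq by (auto simp: c_def)
      then have "{x \<in> U. x \<in> (inv f \<otimes> g) <# A} \<union> {x \<in> U. x \<in> (inv f \<otimes> h) <# A} \<in> \<I>"
        by (rule Un_small)
      then show ?thesis by (rule subset_small) (auto simp: E_def)
    qed
    then have "S \<union> (\<Union>f\<in>F. f <# E f) \<in> \<I>"
      using S(1) F by (intro Un_small UN_small l_coset_small) auto
    moreover have "sym_diff (g <# A) (h <# A) \<subseteq> S \<union> (\<Union>f\<in>F. f <# E f)"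
    proof
      fix x assume x: "x \<in> sym_diff (g <# A) (h <# A)"
      then have "x \<in> carrier G" using l_coset_subset_G A g h by blast
      show "x \<in> S \<union> (\<Union>f\<in>F. f <# E f)"
      proof (cases "x \<in> S")
        case False
        then have "x \<in> F <#> U" using S(2) \<open>x \<in> carrier G\<close> by blast
        then obtain f u where fu: "f \<in> F" "u \<in> U" "x = f \<otimes> u" by (auto simp: set_mult_def)
        moreover have "f \<in> carrier G" "u \<in> carrier G" using fu F U by auto
        ultimately have "u \<in> E f"
          using x g h A by (auto simp: E_def mult_mem_l_coset_iff)
        then show ?thesis using fu by (auto simp: l_coset_def)
      qed simp
    qed
    ultimately show ?thesis by (rule subset_small)
  qed
  have fin: "finite (c ` carrier G)"
    by (rule finite_subset[of _ "Pow F"]) (auto simp: c_def F)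
  define K where "K = inv_into (carrier G) c ` c ` carrier G"
  have "\<exists>k\<in>K. sym_diff (g <# A) (k <# A) \<in> \<I>" if g: "g \<in> carrier G" for g
  proof
    show "inv_into (carrier G) c (c g) \<in> K" using g by (simp add: K_def)
    show "sym_diff (g <# A) (inv_into (carrier G) c (c g) <# A) \<in> \<I>"
      using g by (intro c_eq) (auto simp: inv_into_into f_inv_into_f)
  qed
  moreover have "finite K" "K \<subseteq> carrier G"
    using fin by (auto simp: K_def inv_into_into)
  ultimately show ?thesis by blast
qed

text \<open>The group permutes the finitely many classes of translates of \<open>A\<close> modulo
  the ideal. The kernel of this action is normal and of finite index, and it fixes the class of
  \<open>A\<close> itself.\<close>

lemma stabilizer_finite_index:
  assumes st: "stable_in G A" and A: "A \<subseteq> carrier G"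
  shows "\<exists>N. N \<lhd> G \<and> finite (lcosets N) \<and> (\<forall>n\<in>N. sym_diff (n <# A) A \<in> \<I>)"
proof -
  define E where "E g h \<longleftrightarrow> sym_diff (g <# A) (h <# A) \<in> \<I>" for g h
  have E_sym: "E h g" if "E g h" for g h
    using that by (simp add: E_def Un_commute)
  have E_trans: "E g k" if "E g h" "E h k" for g h k
    using Un_small[OF that[unfolded E_def]] unfolding E_def by (rule subset_small) blast
  have E_refl: "E g g" for g
    by (simp add: E_def empty_small)
  have E_mult: "E (k \<otimes> g) (k \<otimes> h)" if "E g h" "k \<in> carrier G" "g \<in> carrier G" "h \<in> carrier G" for g h k
  proof -
    have "k <# sym_diff (g <# A) (h <# A) \<in> \<I>"
      using that by (simp add: E_def l_coset_small)
    moreover have "sym_diff ((k \<otimes> g) <# A) ((k \<otimes> h) <# A) \<subseteq> k <# sym_diff (g <# A) (h <# A)"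
    proof -
      have "(k \<otimes> g) <# A = k <# (g <# A)" "(k \<otimes> h) <# A = k <# (h <# A)"
        using that A by (simp_all add: lcos_m_assoc)
      then show ?thesis using sym_diff_l_coset by metis
    qed
    ultimately show ?thesis unfolding E_def by (rule subset_small)
  qed
  define N where "N = {n \<in> carrier G. \<forall>g\<in>carrier G. E (n \<otimes> g) g}"
  have "subgroup N G"
  proof (rule subgroupI)
    show "N \<subseteq> carrier G" by (auto simp: N_def)
    show "N \<noteq> {}" by (auto simp: N_def E_refl intro!: exI[of _ \<one>])
    show "inv n \<in> N" if n: "n \<in> N" for n
    proof -
      have nG: "n \<in> carrier G" using n by (simp add: N_def)
      have "E (inv n \<otimes> g) g" if g: "g \<in> carrier G" for g
      proof -
        have "E g (n \<otimes> g)" using n g by (auto simp: N_def intro: E_sym)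
        from E_mult[OF this, of "inv n"] show ?thesis
          using nG g by (simp add: m_assoc[symmetric])
      qed
      then show ?thesis using nG by (simp add: N_def)
    qed
    show "m \<otimes> n \<in> N" if mn: "m \<in> N" "n \<in> N" for m n
    proof -
      have G: "m \<in> carrier G" "n \<in> carrier G" using mn by (auto simp: N_def)
      have "E (m \<otimes> n \<otimes> g) g" if g: "g \<in> carrier G" for g
      proof -
        have "E (m \<otimes> (n \<otimes> g)) (n \<otimes> g)" using mn(1) G g by (simp add: N_def)
        moreover have "E (n \<otimes> g) g" using mn(2) g by (simp add: N_def)
        ultimately show ?thesis using E_trans G g by (simp add: m_assoc)
      qed
      then show ?thesis using G by (simp add: N_def)
    qed
  qed
  moreover have "x \<otimes> n \<otimes> inv x \<in> N" if x: "x \<in> carrier G" and n: "n \<in> N" for x n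
  proof -
    have nG: "n \<in> carrier G" using n by (simp add: N_def)
    have "E (x \<otimes> n \<otimes> inv x \<otimes> g) g" if g: "g \<in> carrier G" for g
    proof -
      have "E (n \<otimes> (inv x \<otimes> g)) (inv x \<otimes> g)" using n x g by (simp add: N_def)
      from E_mult[OF this x] have "E (x \<otimes> (n \<otimes> (inv x \<otimes> g))) (x \<otimes> (inv x \<otimes> g))"
        using x nG g by simp
      moreover have "x \<otimes> (inv x \<otimes> g) = g" using x g by (simp add: m_assoc[symmetric])
      ultimately show ?thesis using x nG g by (simp add: m_assoc)
    qed
    then show ?thesis using x nG by (simp add: N_def)
  qed
  ultimately have norm: "N \<lhd> G" by (simp add: normal_inv_iff)
  obtain K where K: "finite K" "K \<subseteq> carrier G" "\<And>g. g \<in> carrier G \<Longrightarrow> \<exists>k\<in>K. E g k"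
    using finite_translate_classes[OF st A] unfolding E_def by blast
  \<comment> \<open>The action of \<open>g\<close> on representatives, recorded as a relation
    because distinct elements of \<open>K\<close> may represent the same class.\<close>
  define \<phi> where "\<phi> g = {(k, k'). k \<in> K \<and> k' \<in> K \<and> E (g \<otimes> k) k'}" for g
  have "finite (\<phi> ` carrier G)"
    by (rule finite_subset[of _ "Pow (K \<times> K)"]) (auto simp: \<phi>_def K(1))
  moreover have "g <# N = h <# N" if gh: "g \<in> carrier G" "h \<in> carrier G" "\<phi> g = \<phi> h" for g h
  proof -
    have K_eq: "E (h \<otimes> k) (g \<otimes> k)" if k: "k \<in> K" for k
    proof -
      obtain k' where k': "k' \<in> K" "E (g \<otimes> k) k'" using K(3)[of "g \<otimes> k"] k K(2) gh(1) by auto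
      then have "(k, k') \<in> \<phi> g" using k by (simp add: \<phi>_def)
      then have "E (h \<otimes> k) k'" unfolding gh(3) by (simp add: \<phi>_def)
      then show ?thesis using E_trans E_sym[OF k'(2)] by blast
    qed
    have "E (inv g \<otimes> h \<otimes> x) x" if x: "x \<in> carrier G" for x
    proof -
      obtain k where k: "k \<in> K" "E x k" using K(3)[OF x] by blast
      then have kG: "k \<in> carrier G" using K(2) by blast
      have "E (h \<otimes> x) (h \<otimes> k)" "E (g \<otimes> k) (g \<otimes> x)"
        using E_mult[OF k(2) gh(2) x kG] E_sym[OF E_mult[OF k(2) gh(1) x kG]] by simp_all
      then have "E (h \<otimes> x) (g \<otimes> x)" using E_trans[OF _ E_trans[OF K_eq[OF k(1)]]] by simp
      from E_mult[OF this, of "inv g"] show ?thesis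
        using gh x by (simp add: m_assoc[symmetric])
    qed
    then have "inv g \<otimes> h \<in> N" using gh by (simp add: N_def)
    then have "h \<in> g <# N" using gh \<open>subgroup N G\<close>
      by (simp add: mem_l_coset_iff subgroup.subset)
    then show ?thesis using l_repr_independence gh \<open>subgroup N G\<close> by blast
  qed
  ultimately have "finite ((\<lambda>g. g <# N) ` carrier G)" by (rule finite_image_factor)
  moreover have "lcosets N = (\<lambda>g. g <# N) ` carrier G" by (auto simp: LCOSETS_def)
  moreover have "sym_diff (n <# A) A \<in> \<I>" if "n \<in> N" for n
  proof -
    have "E (n \<otimes> \<one>) \<one>" using that one_closed unfolding N_def by blast
    moreover have "n \<in> carrier G" using that by (simp add: N_def)
    ultimately show ?thesis using A by (simp add: E_def lcos_mult_one)
  qed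
  ultimately show ?thesis using norm by auto
qed

text \<open>If \<open>A \<inter> C\<close> is large, finitely many of its translates cover almost
  everything. A translate \<open>f <# (A \<inter> C)\<close> meets \<open>C\<close> only if
  \<open>f\<close> lies in \<open>N\<close>, and then \<open>f <# A\<close> agrees with
  \<open>A\<close> up to a small set; hence almost all of \<open>C\<close> lies in
  \<open>A\<close>.\<close>

lemma coset_dichotomy:
  assumes st: "stable_in G A" and A: "A \<subseteq> carrier G"
  shows "\<exists>N. N \<lhd> G \<and> finite (lcosets N) \<and> (\<forall>C\<in>lcosets N. A \<inter> C \<in> \<I> \<or> C - A \<in> \<I>)"
proof -
  obtain N where N: "N \<lhd> G" "finite (lcosets N)" "\<And>n. n \<in> N \<Longrightarrow> sym_diff (n <# A) A \<in> \<I>"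
    using stabilizer_finite_index[OF assms] by blast
  have "C - A \<in> \<I>" if C: "C \<in> lcosets N" and big: "A \<inter> C \<notin> \<I>" for C
  proof -
    obtain F S where F: "finite F" "F \<subseteq> carrier G" and S: "S \<in> \<I>" "carrier G = (F <#> (A \<inter> C)) \<union> S"
      using cover[OF _ big] A by blast
    have "S \<union> (\<Union>f\<in>F \<inter> N. sym_diff (f <# A) A) \<in> \<I>"
    proof (rule Un_small[OF S(1)], rule UN_small)
      show "finite (F \<inter> N)" using F(1) by simp
      show "sym_diff (f <# A) A \<in> \<I>" if "f \<in> F \<inter> N" for f using N(3)[of f] that by blast
    qed
    moreover have "C - A \<subseteq> S \<union> (\<Union>f\<in>F \<inter> N. sym_diff (f <# A) A)"
    proof
      fix x assume x: "x \<in> C - A"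
      then have xG: "x \<in> carrier G"
        using C N(1) lcosets_part_G normal_imp_subgroup by blast
      show "x \<in> S \<union> (\<Union>f\<in>F \<inter> N. sym_diff (f <# A) A)"
      proof (cases "x \<in> S")
        case False
        then have "x \<in> F <#> (A \<inter> C)" using S(2) xG by blast
        then obtain f u where fu: "f \<in> F" "u \<in> A" "u \<in> C" "x = f \<otimes> u"
          by (auto simp: set_mult_def)
        then have G: "f \<in> carrier G" "u \<in> carrier G" using F A by auto
        have "x \<otimes> inv u = f" using fu G by (simp add: m_assoc)
        then have "f \<in> N" using normal_l_coset_quotient[OF N(1) C, of x u] x fu by auto
        then show ?thesis using fu x by (auto simp: l_coset_def)
      qed simp
    qed
    ultimately show ?thesis by (rule subset_small)
  qed
  then show ?thesis using N by blast
qed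

text \<open>All cosets are translates of one another and finitely many of them cover the group, so
  one small coset would make the whole group small.\<close>

lemma l_coset_not_small:
  assumes "subgroup N G" "finite (lcosets N)" "C \<in> lcosets N"
  shows "C \<notin> \<I>"
proof
  assume C: "C \<in> \<I>"
  obtain g where g: "g \<in> carrier G" "C = g <# N" using assms by (auto simp: LCOSETS_def)
  have N: "N \<subseteq> carrier G" using assms(1) by (rule subgroup.subset)
  have "D \<in> \<I>" if "D \<in> lcosets N" for D
  proof -
    obtain h where h: "h \<in> carrier G" "D = h <# N" using \<open>D \<in> lcosets N\<close> by (auto simp: LCOSETS_def)
    have "h <# (inv g <# C) \<in> \<I>" using C g h by (simp add: l_coset_small)
    moreover have "h <# (inv g <# C) = D" using g h N by (simp add: lcos_m_assoc lcos_mult_one)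
    ultimately show ?thesis by simp
  qed
  then have "(\<Union>D\<in>lcosets N. D) \<in> \<I>" using assms(2) by (rule UN_small[rotated])
  then show False using lcosets_part_G[OF assms(1)] carrier_not_small by simp
qed

text \<open>A nonempty periodic set contains a whole coset. This makes the approximating periodic
  set for a fixed subgroup unique.\<close>

lemma periodic_small_empty:
  assumes "subgroup N G" "finite (lcosets N)" "periodic N Y" "Y \<in> \<I>"
  shows "Y = {}"
proof (rule ccontr)
  assume "Y \<noteq> {}"
  then obtain y where y: "y \<in> Y" by blast
  then have yG: "y \<in> carrier G" using assms(3) by (auto simp: periodic_def)
  have "y <# N \<subseteq> Y" using assms(3) y by (auto simp: periodic_def l_coset_def)
  then have "y <# N \<in> \<I>" using assms(4) subset_small by blast
  moreover have "y <# N \<in> lcosets N" using yG by (auto simp: LCOSETS_def)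
  ultimately show False using l_coset_not_small assms(1,2) by blast
qed

text \<open>\<open>Y\<close> collects the cosets almost filled by \<open>A\<close>; by the dichotomy
  \<open>A\<close> is small on each of the others.\<close>

lemma periodic_approximation:
  assumes st: "stable_in G A" and A: "A \<subseteq> carrier G"
  shows "\<exists>N Y. N \<lhd> G \<and> finite (lcosets N) \<and> periodic N Y \<and> sym_diff A Y \<in> \<I>"
proof -
  obtain N where N: "N \<lhd> G" "finite (lcosets N)"
    and dich: "\<And>C. C \<in> lcosets N \<Longrightarrow> A \<inter> C \<in> \<I> \<or> C - A \<in> \<I>"
    using coset_dichotomy[OF assms] by blast
  have sub: "subgroup N G" using N(1) by (rule normal_imp_subgroup)
  define Y where "Y = \<Union>{C \<in> lcosets N. C - A \<in> \<I>}"
  \<comment> \<open>The exceptional part of \<open>C\<close>: the points missing from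
    \<open>A\<close> where \<open>A\<close> is full, and the points of \<open>A\<close>
    elsewhere.\<close>
  define E where "E C = (if C - A \<in> \<I> then C - A else A \<inter> C)" for C
  have "periodic N Y"
    unfolding periodic_def
  proof (intro conjI ballI)
    show "Y \<subseteq> carrier G" using lcosets_part_G[OF sub] by (auto simp: Y_def)
    show "y \<otimes> n \<in> Y" if "y \<in> Y" "n \<in> N" for y n
    proof -
      obtain C where C: "C \<in> lcosets N" "C - A \<in> \<I>" "y \<in> C" using \<open>y \<in> Y\<close> by (auto simp: Y_def)
      then obtain g where g: "g \<in> carrier G" "C = g <# N" by (auto simp: LCOSETS_def)
      then have "C = y <# N" using l_repr_independence C(3) sub by blast
      then have "y \<otimes> n \<in> C" using that by (auto simp: l_coset_def)
      then show ?thesis using C by (auto simp: Y_def)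
    qed
  qed
  moreover have "(\<Union>C\<in>lcosets N. E C) \<in> \<I>"
    using N(2) dich by (intro UN_small) (auto simp: E_def)
  moreover have "sym_diff A Y \<subseteq> (\<Union>C\<in>lcosets N. E C)"
  proof
    fix x assume x: "x \<in> sym_diff A Y"
    then have "x \<in> carrier G" using A \<open>periodic N Y\<close> by (auto simp: periodic_def)
    then obtain C where C: "C \<in> lcosets N" "x \<in> C" using lcosets_part_G[OF sub] by blast
    have "x \<in> E C"
    proof (cases "x \<in> Y")
      case True
      then obtain D where D: "D \<in> lcosets N" "D - A \<in> \<I>" "x \<in> D" by (auto simp: Y_def)
      then have "D = C" using lcos_disjoint[OF sub, of C D] C by blast
      then show ?thesis using D x True by (auto simp: E_def)
    next
      case False
      then have "C - A \<notin> \<I>" using C by (auto simp: Y_def)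
      then show ?thesis using x False C by (auto simp: E_def)
    qed
    then show "x \<in> (\<Union>C\<in>lcosets N. E C)" using C by blast
  qed
  ultimately show ?thesis using N subset_small by blast
qed

end

section \<open>Comparison of ideals through inversion\<close>

context group
begin

text \<open>Otherwise a half graph arises by alternating choices of \<open>x\<close> in
  \<open>C\<close> and \<open>y\<close> in \<open>N\<close>. Avoiding \<open>A\<close> against
  earlier \<open>y'\<close> excludes a small set of inverses of \<open>x\<close> for
  \<open>\<I>\<^sub>2\<close>; hitting \<open>A\<close> against the \<open>x\<close> so far excludes
  a small set of \<open>y\<close> for \<open>\<I>\<^sub>1\<close>.\<close>

lemma coset_comparison:
  assumes I1: "maximal_ideal G \<I>\<^sub>1" and I2: "maximal_ideal G \<I>\<^sub>2"
    and st: "stable_in G A" and A: "A \<subseteq> carrier G"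
    and N: "N \<lhd> G" "finite (lcosets N)" and C: "C \<in> lcosets N"
    and full: "C - A \<in> \<I>\<^sub>1"
  shows "set_inv (A \<inter> C) \<notin> \<I>\<^sub>2"
proof
  assume empty: "set_inv (A \<inter> C) \<in> \<I>\<^sub>2"
  interpret I1: maximal_ideal G \<I>\<^sub>1 by fact
  interpret I2: maximal_ideal G \<I>\<^sub>2 by fact
  interpret N: normal N G by fact
  have sub: "subgroup N G" by (rule N.subgroup_axioms)
  have CG: "C \<subseteq> carrier G" using C lcosets_part_G[OF sub] by blast
  obtain k where k: "k \<in> carrier G" "C = k <# N" using C by (auto simp: LCOSETS_def)
  have C_mult: "x \<otimes> n \<in> C" if "x \<in> C" "n \<in> N" for x n
    using that k N.subset by (auto simp: l_coset_def) (metis N.m_closed N.mem_carrier m_assoc)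
  have step: "\<exists>s\<in>C \<times> N. case s of (x, y) \<Rightarrow>
      x \<otimes> y \<in> A \<and> (\<forall>(x', y')\<in>set h. x \<otimes> y' \<notin> A \<and> x' \<otimes> y \<in> A)"
    if h: "h \<in> lists (C \<times> N)" for h
  proof -
    have hG: "x' \<in> C" "y' \<in> N" "x' \<in> carrier G" "y' \<in> carrier G" if "(x', y') \<in> set h" for x' y'
      using that h CG N.subset by auto
    have "(\<Union>y'\<in>snd ` set h. y' <# set_inv (A \<inter> C)) \<in> \<I>\<^sub>2"
      using hG empty by (intro I2.UN_small I2.l_coset_small) auto
    \<comment> \<open>Left and right cosets of the normal subgroup \<open>N\<close> coincide, so the
      inverses of \<open>C\<close> contain a full left coset.\<close>
    moreover have "set_inv C \<notin> \<I>\<^sub>2"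
    proof -
      have "inv k <# N \<subseteq> set_inv C"
      proof
        fix z assume z: "z \<in> inv k <# N"
        then have "z \<in> N #> inv k" using N.coset_eq k by auto
        then obtain n where n: "n \<in> N" "z = n \<otimes> inv k" by (auto simp: r_coset_def)
        then have "z = inv (k \<otimes> inv n)" using k N.subset by (auto simp: inv_mult_group)
        moreover have "k \<otimes> inv n \<in> C" using n k by (auto simp: l_coset_def)
        ultimately show "z \<in> set_inv C" by (auto simp: SET_INV_def)
      qed
      moreover have "inv k <# N \<in> lcosets N" using k by (auto simp: LCOSETS_def)
      ultimately show ?thesis using I2.l_coset_not_small[OF sub N(2)] I2.subset_small by blast
    qed
    ultimately obtain z where z: "z \<in> set_inv C" "z \<notin> (\<Union>y'\<in>snd ` set h. y' <# set_inv (A \<inter> C))"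
      using I2.subset_small by blast
    then obtain x where x: "x \<in> C" "z = inv x" by (auto simp: SET_INV_def)
    have avoid: "x \<otimes> y' \<notin> A" if s: "(x', y') \<in> set h" for x' y'
    proof
      assume "x \<otimes> y' \<in> A"
      then have "inv (x \<otimes> y') \<in> set_inv (A \<inter> C)"
        using C_mult x hG[OF s] by (auto simp: SET_INV_def)
      moreover have "inv x = y' \<otimes> inv (x \<otimes> y')"
        using x CG hG[OF s] by (simp add: inv_mult_group m_assoc[symmetric] subset_iff)
      ultimately have "z \<in> y' <# set_inv (A \<inter> C)" using x by (auto simp: l_coset_def)
      then show False using z(2) s by force
    qed
    \<comment> \<open>The new \<open>x\<close> is included among the constraints on
      \<open>y\<close>; this makes the half graph true on its diagonal.\<close>
    have fin: "finite (insert x (fst ` set h))" and subC: "insert x (fst ` set h) \<subseteq> C"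
      using x hG by auto
    have "(\<Union>x'\<in>insert x (fst ` set h). inv x' <# (C - A)) \<in> \<I>\<^sub>1"
      using fin subC CG full by (intro I1.UN_small I1.l_coset_small) auto
    moreover have "N \<notin> \<I>\<^sub>1"
    proof -
      have "\<one> <# N \<in> lcosets N" by (auto simp: LCOSETS_def)
      then show ?thesis using I1.l_coset_not_small[OF sub N(2)] N.subset by (simp add: lcos_mult_one)
    qed
    ultimately obtain y where y: "y \<in> N" "y \<notin> (\<Union>x'\<in>insert x (fst ` set h). inv x' <# (C - A))"
      using I1.subset_small by blast
    have hit: "x' \<otimes> y \<in> A" if x': "x' \<in> insert x (fst ` set h)" for x'
    proof (rule ccontr)
      assume "x' \<otimes> y \<notin> A"
      then have "x' \<otimes> y \<in> C - A" using C_mult x' subC y by blast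
      moreover have "y = inv x' \<otimes> (x' \<otimes> y)"
      proof -
        have "x' \<in> carrier G" "y \<in> carrier G" using x' subC CG y(1) N.subset by blast+
        then show ?thesis by (simp add: m_assoc[symmetric])
      qed
      ultimately have "y \<in> inv x' <# (C - A)" by (auto simp: l_coset_def)
      then show False using y(2) x' by blast
    qed
    have "\<forall>(x', y')\<in>set h. x \<otimes> y' \<notin> A \<and> x' \<otimes> y \<in> A"
    proof clarify
      fix x' y' assume s: "(x', y') \<in> set h"
      then have "x' \<in> fst ` set h" by force
      then show "x \<otimes> y' \<notin> A \<and> x' \<otimes> y \<in> A" using avoid[OF s] hit by blast
    qed
    then show ?thesis using x y hit by auto
  qed
  obtain f where f: "\<And>n. f n \<in> C \<times> N"
    "\<And>n. case f n of (x, y) \<Rightarrow>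
      x \<otimes> y \<in> A \<and> (\<forall>(x', y')\<in>set (map f [0..<n]). x \<otimes> y' \<notin> A \<and> x' \<otimes> y \<in> A)"
    using history_choice[of "C \<times> N" "\<lambda>h s. case s of (x, y) \<Rightarrow>
      x \<otimes> y \<in> A \<and> (\<forall>(x', y')\<in>set h. x \<otimes> y' \<notin> A \<and> x' \<otimes> y \<in> A)"] step by blast
  define x y where xy: "x n = fst (f n)" "y n = snd (f n)" for n
  have f_eq: "f n = (x n, y n)" for n by (simp add: xy)
  have "x i \<otimes> y j \<in> A \<longleftrightarrow> i \<le> j" for i j
  proof (cases i j rule: linorder_cases)
    case less
    then show ?thesis using f(2)[of j] by (force simp: f_eq)
  next
    case equal
    then show ?thesis using f(2)[of j] by (simp add: f_eq)
  next
    case greater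
    then show ?thesis using f(2)[of i] by (force simp: f_eq)
  qed
  moreover have "range x \<subseteq> carrier G" "range y \<subseteq> carrier G"
    using f(1) CG N.subset by (auto simp: f_eq)
  ultimately show False
    using half_graph_free_le[OF stable_half_graph_free[OF st], of x y] by blast
qed

text \<open>If the inverse of \<open>A\<close> were large for \<open>\<I>\<^sub>2\<close>, it would
  be full on some coset. The comparison, with the ideals exchanged, then makes a subset of
  \<open>A\<close> large for \<open>\<I>\<^sub>1\<close>.\<close>

lemma set_inv_small:
  assumes I1: "maximal_ideal G \<I>\<^sub>1" and I2: "maximal_ideal G \<I>\<^sub>2"
    and st: "stable_in G A" and A: "A \<subseteq> carrier G" and small: "A \<in> \<I>\<^sub>1"
  shows "set_inv A \<in> \<I>\<^sub>2"
proof (rule ccontr)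
  assume big: "set_inv A \<notin> \<I>\<^sub>2"
  interpret I1: maximal_ideal G \<I>\<^sub>1 by fact
  interpret I2: maximal_ideal G \<I>\<^sub>2 by fact
  have st': "stable_in G (set_inv A)" and A': "set_inv A \<subseteq> carrier G"
    using st A by (simp_all add: stable_set_inv set_inv_subset)
  obtain N where N: "N \<lhd> G" "finite (lcosets N)"
    and dich: "\<And>C. C \<in> lcosets N \<Longrightarrow> set_inv A \<inter> C \<in> \<I>\<^sub>2 \<or> C - set_inv A \<in> \<I>\<^sub>2"
    using I2.coset_dichotomy[OF st' A'] by blast
  have "(\<Union>C\<in>lcosets N. set_inv A \<inter> C) = set_inv A"
    using lcosets_part_G[OF normal_imp_subgroup[OF N(1)]] A' by blast
  then obtain C where C: "C \<in> lcosets N" "set_inv A \<inter> C \<notin> \<I>\<^sub>2"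
    using I2.UN_small[OF N(2), of "\<lambda>C. set_inv A \<inter> C"] big by metis
  then have "C - set_inv A \<in> \<I>\<^sub>2" using dich by blast
  then have "set_inv (set_inv A \<inter> C) \<notin> \<I>\<^sub>1"
    by (rule coset_comparison[OF I2 I1 st' A' N C(1)])
  moreover have "set_inv (set_inv A \<inter> C) \<subseteq> A"
    using set_inv_set_inv[OF A] by (auto simp: SET_INV_def)
  ultimately show False using small I1.subset_small by blast
qed

end

context maximal_ideal
begin

lemma set_inv_small_iff:
  assumes "stable_in G A" "A \<subseteq> carrier G"
  shows "set_inv A \<in> \<I> \<longleftrightarrow> A \<in> \<I>"
  using set_inv_small[OF maximal_ideal_axioms maximal_ideal_axioms] assms
  by (metis set_inv_set_inv set_inv_subset stable_set_inv)

text \<open>Inversion turns the right translate into a left one: the inverse of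
  \<open>A #> g\<close> is \<open>inv g <# set_inv A\<close>, and stable smallness is preserved by
  inversion.\<close>

lemma r_coset_small:
  assumes st: "stable_in G A" and A: "A \<subseteq> carrier G" and g: "g \<in> carrier G" and small: "A \<in> \<I>"
  shows "A #> g \<in> \<I>"
proof -
  have "inv g <# set_inv A \<in> \<I>"
    using small g by (simp add: l_coset_small set_inv_small_iff[OF st A])
  moreover have "set_inv (A #> g) \<subseteq> inv g <# set_inv A"
    using A g by (force simp: SET_INV_def r_coset_def l_coset_def inv_mult_group)
  ultimately have "set_inv (A #> g) \<in> \<I>" by (rule subset_small)
  then show ?thesis
    using set_inv_small_iff[OF stable_r_coset[OF st A g]] A g by (simp add: r_coset_subset_G)
qed

end

section \<open>Densities of unions of cosets\<close>

locale left_invariant_algebra = group G + algebra "carrier G" \<B> for G (structure) and \<B> +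
  assumes l_coset_closed: "g \<in> carrier G \<Longrightarrow> A \<in> \<B> \<Longrightarrow> g <# A \<in> \<B>"
begin

lemma in_carrier: "A \<in> \<B> \<Longrightarrow> A \<subseteq> carrier G"
  using space_closed by blast

lemma sym_diff_closed: "A \<in> \<B> \<Longrightarrow> B \<in> \<B> \<Longrightarrow> sym_diff A B \<in> \<B>"
  by blast

context
  fixes \<mu>
  assumes \<mu>: "fin_add_prob G \<B> \<mu>"
begin

lemma prob_nonneg: "A \<in> \<B> \<Longrightarrow> 0 \<le> \<mu> A"
  and prob_le_1: "A \<in> \<B> \<Longrightarrow> \<mu> A \<le> 1"
  and prob_carrier: "\<mu> (carrier G) = 1"
  and prob_Un: "A \<in> \<B> \<Longrightarrow> B \<in> \<B> \<Longrightarrow> A \<inter> B = {} \<Longrightarrow> \<mu> (A \<union> B) = \<mu> A + \<mu> B"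
  using \<mu> by (auto simp: fin_add_prob_def Measure_Space.additive_def)

lemma prob_empty: "\<mu> {} = 0"
  using prob_Un[of "{}" "{}"] by simp

lemma prob_Diff: "A \<in> \<B> \<Longrightarrow> B \<in> \<B> \<Longrightarrow> \<mu> A = \<mu> (A \<inter> B) + \<mu> (A - B)"
  using prob_Un[of "A \<inter> B" "A - B"] by (simp add: Int_Diff_Un Int_Diff_disjoint Int Diff)

lemma prob_mono: "A \<in> \<B> \<Longrightarrow> B \<in> \<B> \<Longrightarrow> A \<subseteq> B \<Longrightarrow> \<mu> A \<le> \<mu> B"
  using prob_Diff[of B A] prob_nonneg[of "B - A"] by (simp add: Int_absorb1 Diff)

lemma prob_Un_Int: "A \<in> \<B> \<Longrightarrow> B \<in> \<B> \<Longrightarrow> \<mu> (A \<union> B) + \<mu> (A \<inter> B) = \<mu> A + \<mu> B"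
  using prob_Un[of A "B - A"] prob_Diff[of B A] by (simp add: Int_commute Diff)

lemma prob_UN_le:
  "finite I \<Longrightarrow> (\<And>i. i \<in> I \<Longrightarrow> E i \<in> \<B>) \<Longrightarrow> \<mu> (\<Union>i\<in>I. E i) \<le> (\<Sum>i\<in>I. \<mu> (E i))"
proof (induction I rule: finite_induct)
  case (insert i I)
  then have "(\<Union>i\<in>I. E i) \<in> \<B>" by (intro finite_UN) auto
  then show ?case
    using insert prob_Un_Int[of "E i" "\<Union>i\<in>I. E i"] prob_nonneg[of "E i \<inter> (\<Union>i\<in>I. E i)"]
    by (simp add: Int)
qed (simp add: prob_empty)

lemma prob_UN_null:
  assumes "finite I" "\<And>i. i \<in> I \<Longrightarrow> E i \<in> \<B>" "\<And>i. i \<in> I \<Longrightarrow> \<mu> (E i) = 0"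
  shows "\<mu> (\<Union>i\<in>I. E i) = 0"
  using prob_UN_le[of I E] prob_nonneg[of "\<Union>i\<in>I. E i"] assms by (simp add: finite_UN)

text \<open>Null overlaps suffice; for the translates in \<open>positive_intersection_step\<close>
  nothing stronger is known.\<close>

lemma prob_UN_almost_disjoint:
  assumes "finite I" "\<And>i. i \<in> I \<Longrightarrow> E i \<in> \<B>"
    and "\<And>i j. i \<in> I \<Longrightarrow> j \<in> I \<Longrightarrow> i \<noteq> j \<Longrightarrow> \<mu> (E i \<inter> E j) = 0"
  shows "\<mu> (\<Union>i\<in>I. E i) = (\<Sum>i\<in>I. \<mu> (E i))"
  using assms
proof (induction I rule: finite_induct)
  case (insert i I)
  have E: "E i \<in> \<B>" "\<And>j. j \<in> I \<Longrightarrow> E j \<in> \<B>" using insert.prems(1) by simp_all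
  have "\<mu> (E i \<inter> E j) = 0" if "j \<in> I" for j
    using insert.prems(2)[of i j] insert.hyps(2) that by auto
  then have "\<mu> (\<Union>j\<in>I. E i \<inter> E j) = 0"
    using insert.hyps(1) E by (intro prob_UN_null) (simp_all add: Int)
  then have "\<mu> (E i \<inter> (\<Union>j\<in>I. E j)) = 0" by (simp only: Int_UN_distrib)
  moreover have "E i \<in> \<B>" "(\<Union>j\<in>I. E j) \<in> \<B>" using E insert.hyps(1) by (simp_all add: finite_UN)
  ultimately have "\<mu> (E i \<union> (\<Union>j\<in>I. E j)) = \<mu> (E i) + \<mu> (\<Union>j\<in>I. E j)"
    using prob_Un_Int[of "E i" "\<Union>j\<in>I. E j"] by linarith
  also have "\<mu> (\<Union>j\<in>I. E j) = (\<Sum>j\<in>I. \<mu> (E j))" using insert.prems by (intro insert.IH) simp_all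
  finally show ?case using insert.hyps by simp
qed (simp add: prob_empty)

lemma prob_eq_of_sym_diff_null:
  assumes "A \<in> \<B>" "B \<in> \<B>" "\<mu> (sym_diff A B) = 0"
  shows "\<mu> A = \<mu> B"
proof -
  have "\<mu> (A - B) \<le> \<mu> (sym_diff A B)" "\<mu> (B - A) \<le> \<mu> (sym_diff A B)"
    using assms(1,2) by (intro prob_mono; blast)+
  then have "\<mu> (A - B) = 0" "\<mu> (B - A) = 0"
    using assms prob_nonneg[of "A - B"] prob_nonneg[of "B - A"] by (simp_all add: Diff)
  then show ?thesis
    using prob_Diff[of A B] prob_Diff[of B A] assms by (simp add: Int_commute)
qed

end

lemma prob_generic_pos:
  assumes \<mu>: "left_invariant_prob G \<B> \<mu>" and A: "A \<in> \<B>" "generic_in G A"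
  shows "\<mu> A > 0"
proof -
  have prob: "fin_add_prob G \<B> \<mu>" and inv: "\<And>g. g \<in> carrier G \<Longrightarrow> \<mu> (g <# A) = \<mu> A"
    using \<mu> A(1) by (auto simp: left_invariant_prob_def)
  obtain F where F: "finite F" "F \<subseteq> carrier G" "carrier G = F <#> A"
    using A(2) by (auto simp: generic_in_def)
  have "1 = \<mu> (\<Union>f\<in>F. f <# A)" using F(3) prob_carrier[OF prob] by (simp add: set_mult_UN)
  also have "\<dots> \<le> (\<Sum>f\<in>F. \<mu> (f <# A))"
    using F A(1) by (intro prob_UN_le[OF prob]) (auto intro: l_coset_closed)
  also have "\<dots> = card F * \<mu> A" using F(2) by (simp add: inv subset_iff)
  finally have "\<mu> A \<noteq> 0" by auto
  then show ?thesis using prob_nonneg[OF prob A(1)] by simp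
qed

text \<open>The cosets of \<open>H\<close> are disjoint translates of \<open>H\<close>, so each has
  measure one over the index. This forces the value of every left-invariant probability on their
  unions.\<close>

lemma prob_coset_union:
  assumes \<mu>: "left_invariant_prob G \<B> \<mu>"
    and H: "subgroup H G" "finite (lcosets H)" "H \<in> \<B>" and \<D>: "\<D> \<subseteq> lcosets H"
  shows "\<Union>\<D> \<in> \<B>"
    and "\<mu> (\<Union>\<D>) = real (card {C \<in> lcosets H. C \<subseteq> \<Union>\<D>}) / real (card (lcosets H))"
proof -
  have prob: "fin_add_prob G \<B> \<mu>" and inv: "\<And>g. g \<in> carrier G \<Longrightarrow> \<mu> (g <# H) = \<mu> H"
    using \<mu> H(3) by (auto simp: left_invariant_prob_def)
  have cos: "C \<in> \<B>" "\<mu> C = \<mu> H" if "C \<in> lcosets H" for C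
    using that inv l_coset_closed H(3) by (auto simp: LCOSETS_def)
  have sum: "\<Union>\<E> \<in> \<B>" "\<mu> (\<Union>\<E>) = card \<E> * \<mu> H" if \<E>: "\<E> \<subseteq> lcosets H" for \<E>
  proof -
    have fin: "finite \<E>" using \<E> H(2) finite_subset by blast
    then show "\<Union>\<E> \<in> \<B>" using cos \<E> by (intro finite_Union) auto
    have "C \<inter> D = {}" if "C \<in> \<E>" "D \<in> \<E>" "C \<noteq> D" for C D
      using lcos_disjoint[OF H(1), of C D] that \<E> by blast
    then have "\<mu> (\<Union>C\<in>\<E>. C) = (\<Sum>C\<in>\<E>. \<mu> C)"
      using cos \<E> by (intro prob_UN_almost_disjoint[OF prob fin]) (auto simp: prob_empty[OF prob])
    also have "\<dots> = (\<Sum>C\<in>\<E>. \<mu> H)" using cos \<E> by (intro sum.cong) auto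
    finally show "\<mu> (\<Union>\<E>) = card \<E> * \<mu> H" by simp
  qed
  show "\<Union>\<D> \<in> \<B>" by (rule sum(1)[OF \<D>])
  have one: "1 = card (lcosets H) * \<mu> H"
    using sum(2)[of "lcosets H"] lcosets_part_G[OF H(1)] prob_carrier[OF prob] by simp
  then have "card (lcosets H) \<noteq> 0" by (intro notI) simp
  with one have "\<mu> H = 1 / card (lcosets H)" by (simp add: nonzero_eq_divide_eq mult.commute)
  \<comment> \<open>Cosets are nonempty and pairwise disjoint, so a coset inside the union is
    already one of its members.\<close>
  moreover have "{C \<in> lcosets H. C \<subseteq> \<Union>\<D>} = \<D>"
  proof (intro equalityI subsetI)
    fix C assume C: "C \<in> {C \<in> lcosets H. C \<subseteq> \<Union>\<D>}"
    then obtain g where g: "g \<in> carrier G" "C = g <# H" by (auto simp: LCOSETS_def)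
    then have "g \<in> C" using lcos_self H(1) by blast
    then obtain D where "D \<in> \<D>" "g \<in> D" using C by blast
    then show "C \<in> \<D>" using lcos_disjoint[OF H(1), of C D] C \<D> \<open>g \<in> C\<close> by blast
  qed (use \<D> in auto)
  ultimately show "\<mu> (\<Union>\<D>) = real (card {C \<in> lcosets H. C \<subseteq> \<Union>\<D>}) / real (card (lcosets H))"
    using sum(2)[OF \<D>] by simp
qed

end

section \<open>Normalised counting on finite coset spaces\<close>

context group
begin

text \<open>Meant for \<open>N\<close>-periodic \<open>Y\<close> and finite index, where it is the
  uniform probability on the coset space.\<close>

definition coset_density :: "'a set \<Rightarrow> 'a set \<Rightarrow> real" where
  "coset_density N Y = real (card {C \<in> lcosets N. C \<subseteq> Y}) / real (card (lcosets N))"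

lemma periodic_Diff:
  assumes "subgroup N G" "periodic N Y" "periodic N Z"
  shows "periodic N (Y - Z)"
proof -
  interpret N: subgroup N G by fact
  have "y \<otimes> n \<notin> Z" if y: "y \<in> Y" "y \<notin> Z" and n: "n \<in> N" for y n
  proof
    assume "y \<otimes> n \<in> Z"
    then have "y \<otimes> n \<otimes> inv n \<in> Z" using assms n by (auto simp: periodic_def)
    moreover have "y \<otimes> n \<otimes> inv n = y" using y n assms by (simp add: periodic_def m_assoc subset_iff)
    ultimately show False using y by simp
  qed
  moreover have "Y \<subseteq> carrier G" "\<And>y n. y \<in> Y \<Longrightarrow> n \<in> N \<Longrightarrow> y \<otimes> n \<in> Y"
    using assms(2) by (simp_all add: periodic_def)
  ultimately show ?thesis unfolding periodic_def by auto
qed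

lemma periodic_Un: "periodic N Y \<Longrightarrow> periodic N Z \<Longrightarrow> periodic N (Y \<union> Z)"
  and periodic_Int: "periodic N Y \<Longrightarrow> periodic N Z \<Longrightarrow> periodic N (Y \<inter> Z)"
  and periodic_mono: "periodic N Y \<Longrightarrow> M \<subseteq> N \<Longrightarrow> periodic M Y"
  by (auto simp: periodic_def)

lemma periodic_carrier: "subgroup N G \<Longrightarrow> periodic N (carrier G)"
  by (auto simp: periodic_def subgroup.mem_carrier)

lemma periodic_subgroup: "subgroup N G \<Longrightarrow> periodic N N"
  by (auto simp: periodic_def subgroup.m_closed subgroup.mem_carrier)

lemma periodic_l_coset:
  assumes "subgroup N G" "periodic N Y" "g \<in> carrier G"
  shows "periodic N (g <# Y)"
  unfolding periodic_def
proof (intro conjI ballI)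
  have Y: "Y \<subseteq> carrier G" using assms by (simp add: periodic_def)
  show "g <# Y \<subseteq> carrier G" using Y assms by (simp add: l_coset_subset_G)
  fix z n assume z: "z \<in> g <# Y" and n: "n \<in> N"
  then obtain y where y: "y \<in> Y" "z = g \<otimes> y" by (auto simp: l_coset_def)
  have "y \<in> carrier G" "n \<in> carrier G" using y Y n assms(1) subgroup.mem_carrier by auto
  then have "z \<otimes> n = g \<otimes> (y \<otimes> n)" using y assms by (simp add: m_assoc)
  then show "z \<otimes> n \<in> g <# Y" using y n assms by (auto simp: periodic_def l_coset_def)
qed

lemma periodic_coset_subset:
  assumes "periodic N Y" "y \<in> Y"
  shows "y <# N \<subseteq> Y"
  using assms by (auto simp: periodic_def l_coset_def)

lemma periodic_eq_Union:
  assumes "subgroup N G" "periodic N Y"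
  shows "Y = \<Union>{C \<in> lcosets N. C \<subseteq> Y}"
proof
  show "Y \<subseteq> \<Union>{C \<in> lcosets N. C \<subseteq> Y}"
  proof
    fix y assume y: "y \<in> Y"
    then have "y \<in> carrier G" using assms by (auto simp: periodic_def)
    then have "y <# N \<in> lcosets N" "y \<in> y <# N" using assms by (auto simp: LCOSETS_def lcos_self)
    then show "y \<in> \<Union>{C \<in> lcosets N. C \<subseteq> Y}" using periodic_coset_subset[OF assms(2) y] by blast
  qed
qed auto

lemma finite_lcosets_mono:
  assumes "subgroup M G" "subgroup N G" "M \<subseteq> N" "finite (lcosets M)"
  shows "finite (lcosets N)"
proof -
  have eq: "lcosets K = (\<lambda>g. g <# K) ` carrier G" for K by (auto simp: LCOSETS_def)
  have "finite ((\<lambda>g. g <# N) ` carrier G)"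
  proof (rule finite_image_factor)
    show "finite ((\<lambda>g. g <# M) ` carrier G)" using assms(4) by (simp add: eq)
    fix g h assume gh: "g \<in> carrier G" "h \<in> carrier G" "g <# M = h <# M"
    then have "h \<in> g <# M" using lcos_self assms(1) by blast
    then have "h \<in> g <# N" using assms(3) by (auto simp: l_coset_def)
    then show "g <# N = h <# N" using l_repr_independence gh assms(2) by blast
  qed
  then show ?thesis by (simp add: eq)
qed

text \<open>A coset of the intersection is determined by the pair of cosets of \<open>M\<close> and
  of \<open>N\<close> with the same representative.\<close>

lemma finite_lcosets_Int:
  assumes "subgroup M G" "subgroup N G" "finite (lcosets M)" "finite (lcosets N)"
  shows "finite (lcosets (M \<inter> N))"
proof -
  have eq: "lcosets K = (\<lambda>g. g <# K) ` carrier G" for K by (auto simp: LCOSETS_def)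
  have "finite ((\<lambda>g. g <# (M \<inter> N)) ` carrier G)"
  proof (rule finite_image_factor)
    show "finite ((\<lambda>g. (g <# M, g <# N)) ` carrier G)"
      by (rule finite_subset[of _ "(lcosets M) \<times> (lcosets N)"]) (use assms in \<open>auto simp: eq\<close>)
    fix g h assume gh: "g \<in> carrier G" "h \<in> carrier G" "(g <# M, g <# N) = (h <# M, h <# N)"
    then have "h \<in> g <# M" "h \<in> g <# N" using lcos_self assms by auto
    then have "h \<in> g <# (M \<inter> N)"
      using gh assms by (simp add: mem_l_coset_iff subgroup.subset le_infI1)
    then show "g <# (M \<inter> N) = h <# (M \<inter> N)"
      using l_repr_independence gh subgroups_Inter_pair[OF assms(1,2)] by blast
  qed
  then show ?thesis by (simp add: eq)
qed

lemma coset_density_l_coset: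
  assumes N: "subgroup N G" and Y: "Y \<subseteq> carrier G" and g: "g \<in> carrier G"
  shows "coset_density N (g <# Y) = coset_density N Y"
proof -
  have "bij_betw (\<lambda>C. g <# C) {C \<in> lcosets N. C \<subseteq> Y} {C \<in> lcosets N. C \<subseteq> g <# Y}"
  proof (rule bij_betw_byWitness[where f' = "\<lambda>C. inv g <# C"])
    have NG: "N \<subseteq> carrier G" using N by (rule subgroup.subset)
    have CG: "C \<subseteq> carrier G" if "C \<in> lcosets N" for C using that lcosets_part_G[OF N] by blast
    show "\<forall>C\<in>{C \<in> lcosets N. C \<subseteq> Y}. inv g <# (g <# C) = C"
      "\<forall>C\<in>{C \<in> lcosets N. C \<subseteq> g <# Y}. g <# (inv g <# C) = C"
      using CG g by (auto simp: lcos_m_assoc lcos_mult_one)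
    have cl: "h <# C \<in> lcosets N" if "C \<in> lcosets N" "h \<in> carrier G" for C h
      using that NG by (auto simp: LCOSETS_def lcos_m_assoc)
    have mono: "h <# C \<subseteq> h <# D" if "C \<subseteq> D" for h C D using that by (auto simp: l_coset_def)
    show "(\<lambda>C. g <# C) ` {C \<in> lcosets N. C \<subseteq> Y} \<subseteq> {C \<in> lcosets N. C \<subseteq> g <# Y}"
      using cl g mono by blast
    have "inv g <# (g <# Y) = Y" using g Y by (simp add: lcos_m_assoc lcos_mult_one)
    then show "(\<lambda>C. inv g <# C) ` {C \<in> lcosets N. C \<subseteq> g <# Y} \<subseteq> {C \<in> lcosets N. C \<subseteq> Y}"
      using cl[OF _ inv_closed[OF g]] mono[of _ "g <# Y" "inv g"] by auto
  qed
  then show ?thesis unfolding coset_density_def by (simp add: bij_betw_same_card)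
qed

lemma lcosets_nonempty: "lcosets N \<noteq> {}"
  by (auto simp: LCOSETS_def)

lemma lcoset_nonempty: "subgroup N G \<Longrightarrow> C \<in> lcosets N \<Longrightarrow> C \<noteq> {}"
  using lcos_self by (auto simp: LCOSETS_def)

lemma coset_density_Un:
  assumes N: "subgroup N G" "finite (lcosets N)" and Y: "periodic N Y" "periodic N Z" "Y \<inter> Z = {}"
  shows "coset_density N (Y \<union> Z) = coset_density N Y + coset_density N Z"
proof -
  have "C \<subseteq> Y \<or> C \<subseteq> Z" if C: "C \<in> lcosets N" "C \<subseteq> Y \<union> Z" for C
  proof -
    obtain g where g: "g \<in> carrier G" "C = g <# N" using C by (auto simp: LCOSETS_def)
    then have "g \<in> Y \<union> Z" using lcos_self N(1) C(2) by blast
    then show ?thesis using periodic_coset_subset Y g by blast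
  qed
  then have "{C \<in> lcosets N. C \<subseteq> Y \<union> Z} = {C \<in> lcosets N. C \<subseteq> Y} \<union> {C \<in> lcosets N. C \<subseteq> Z}"
    by blast
  moreover have "{C \<in> lcosets N. C \<subseteq> Y} \<inter> {C \<in> lcosets N. C \<subseteq> Z} = {}"
    using Y(3) lcoset_nonempty[OF N(1)] by blast
  ultimately have "card {C \<in> lcosets N. C \<subseteq> Y \<union> Z} =
      card {C \<in> lcosets N. C \<subseteq> Y} + card {C \<in> lcosets N. C \<subseteq> Z}"
    using N(2) by (simp add: card_Un_disjoint)
  then show ?thesis by (simp add: coset_density_def add_divide_distrib)
qed

lemma coset_density_carrier:
  assumes "subgroup N G" "finite (lcosets N)"
  shows "coset_density N (carrier G) = 1"
proof -
  have "{C \<in> lcosets N. C \<subseteq> carrier G} = lcosets N" using lcosets_part_G[OF assms(1)] by blast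
  then show ?thesis using assms(2) lcosets_nonempty by (simp add: coset_density_def)
qed

lemma coset_density_bounds:
  assumes "finite (lcosets N)"
  shows "0 \<le> coset_density N Y" "coset_density N Y \<le> 1"
proof -
  have "card {C \<in> lcosets N. C \<subseteq> Y} \<le> card (lcosets N)"
    by (rule card_mono[OF assms]) auto
  then show "coset_density N Y \<le> 1" by (simp add: coset_density_def divide_simps)
qed (simp add: coset_density_def)

text \<open>The density over the smaller subgroup \<open>M\<close> is itself a left-invariant probability on the
  \<open>M\<close>-periodic sets, so its value on unions of cosets of \<open>N\<close> is forced.\<close>

lemma coset_density_refine:
  assumes M: "subgroup M G" "finite (lcosets M)" and N: "subgroup N G" "M \<subseteq> N"
    and Y: "periodic N Y"
  shows "coset_density M Y = coset_density N Y"
proof -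
  let ?P = "{Z. periodic M Z}"
  \<comment> \<open>Measures are extensional, hence the restriction to the periodic sets.\<close>
  let ?d = "restrict (coset_density M) ?P"
  have "algebra (carrier G) ?P"
    unfolding algebra_iff_Un
    using M by (auto simp: periodic_Un periodic_Diff periodic_carrier) (auto simp: periodic_def)
  then interpret P: left_invariant_algebra G ?P
    using M(1) by (auto intro!: left_invariant_algebra.intro is_group
        simp: left_invariant_algebra_axioms_def periodic_l_coset)
  have "left_invariant_prob G ?P ?d"
    unfolding left_invariant_prob_def fin_add_prob_def
  proof (intro conjI ballI)
    show "?d \<in> ?P \<rightarrow>\<^sub>E {0..1}" by (auto simp: coset_density_bounds[OF M(2)])
    show "Measure_Space.additive ?P ?d"
      by (auto simp: Measure_Space.additive_def periodic_Un coset_density_Un[OF M])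
    show "?d (carrier G) = 1" using M by (simp add: periodic_carrier coset_density_carrier)
    show "?d (g <# A) = ?d A" if "g \<in> carrier G" "A \<in> ?P" for g A
    proof -
      have "A \<subseteq> carrier G" "periodic M A" using that by (simp_all add: periodic_def)
      then show ?thesis using that M(1) by (simp add: periodic_l_coset coset_density_l_coset)
    qed
  qed
  then have "?d (\<Union>{C \<in> lcosets N. C \<subseteq> Y}) =
      real (card {C \<in> lcosets N. C \<subseteq> \<Union>{C \<in> lcosets N. C \<subseteq> Y}}) / real (card (lcosets N))"
  proof (rule P.prob_coset_union(2))
    show "finite (lcosets N)" using M N finite_lcosets_mono by blast
    show "N \<in> ?P" using N periodic_mono periodic_subgroup by blast
  qed (use N in auto)
  then show ?thesis
    using periodic_eq_Union[OF N(1) Y] periodic_mono[OF Y N(2)] by (simp add: coset_density_def)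
qed

end

section \<open>Algebras of stable sets\<close>

text \<open>By the pigeonhole principle infinitely many \<open>b i\<close> share a coset of
  \<open>N\<close>. For these indices all products lie in \<open>Y\<close> as soon as the diagonal
  ones do, so \<open>A\<close> alone codes an infinite suborder.\<close>

lemma (in group) stable_Int_periodic:
  assumes N: "subgroup N G" "finite (lcosets N)" and Y: "periodic N Y" and st: "stable_in G A"
  shows "stable_in G (A \<inter> Y)"
  unfolding stable_in_def
proof clarify
  fix I :: "'a set" and r a b
  assume I: "infinite I" "linear_order_on I r" and ab: "a \<in> I \<rightarrow> carrier G" "b \<in> I \<rightarrow> carrier G"
    and R: "\<forall>i\<in>I. \<forall>j\<in>I. (a i \<otimes> b j \<in> A \<inter> Y) = ((i, j) \<in> r)"
  have "(\<lambda>i. b i <# N) ` I \<subseteq> lcosets N" using ab by (auto simp: LCOSETS_def)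
  then have "finite ((\<lambda>i. b i <# N) ` I)" using N(2) finite_subset by blast
  then obtain k where k: "k \<in> I" "infinite {i \<in> I. b i <# N = b k <# N}"
    using pigeonhole_infinite[OF I(1)] by blast
  define J where "J = {i \<in> I. b i <# N = b k <# N}"
  have JI: "J \<subseteq> I" by (auto simp: J_def)
  have Y_mem: "a i \<otimes> b j \<in> Y" if ij: "i \<in> J" "j \<in> J" for i j
  proof -
    have G: "a i \<in> carrier G" "b i \<in> carrier G" "b j \<in> carrier G" using ab ij JI by auto
    have "(i, i) \<in> r" using I(2) ij JI by (auto simp: order_on_defs refl_on_def)
    then have "a i \<otimes> b i \<in> Y" using R ij JI by blast
    moreover have "b j \<in> b i <# N" using ij lcos_self[OF G(3) N(1)] by (simp add: J_def)
    then obtain n where "n \<in> N" "b j = b i \<otimes> n" by (auto simp: l_coset_def)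
    moreover have "n \<in> carrier G" using \<open>n \<in> N\<close> N(1) by (rule subgroup.mem_carrier[rotated])
    ultimately show ?thesis using Y G by (simp add: periodic_def m_assoc[symmetric])
  qed
  have lin: "linear_order_on J (Restr r J)" 
  proof -
    have "trans r" "antisym r" "refl_on I r" "total_on I r" using I(2) by (auto simp: order_on_defs)
    then have "trans (Restr r J)" "antisym (Restr r J)" "refl_on J (Restr r J)" "total_on J (Restr r J)"
      using JI by (auto intro: trans_Restr antisym_subset simp: refl_on_def total_on_def subset_iff)
    then show ?thesis by (auto simp: order_on_defs)
  qed
  have "a \<in> J \<rightarrow> carrier G" "b \<in> J \<rightarrow> carrier G" using ab JI by auto
  then have "\<not> (\<forall>i\<in>J. \<forall>j\<in>J. a i \<otimes> b j \<in> A \<longleftrightarrow> (i, j) \<in> Restr r J)"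
    using stable_in_any_index[OF st _ lin] k(2) by (simp add: J_def)
  moreover have "a i \<otimes> b j \<in> A \<longleftrightarrow> (i, j) \<in> Restr r J" if "i \<in> J" "j \<in> J" for i j
    using R Y_mem[OF that] that JI by blast
  ultimately show False by blast
qed

section \<open>Small sets are null for every invariant probability\<close>

locale stable_algebra = left_invariant_algebra +
  assumes stable: "A \<in> \<B> \<Longrightarrow> stable_in G A"
begin

text \<open>Otherwise infinitely many translates of \<open>E\<close> would be pairwise disjoint up to null sets.\<close>

lemma positive_intersection_step:
  assumes \<mu>: "left_invariant_prob G \<B> \<mu>" and I: "maximal_ideal G \<I>"
    and A: "A \<in> \<B>" "A \<in> \<I>" and E: "E \<in> \<B>" "E \<subseteq> A" "\<mu> E > 0"
    and Z: "finite Z" "Z \<subseteq> carrier G"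
  shows "\<exists>x\<in>carrier G. (\<forall>z\<in>Z. x \<otimes> z \<notin> A) \<and> \<mu> (E \<inter> (inv x <# A)) > 0"
proof (rule ccontr)
  assume none: "\<not> ?thesis"
  interpret I: maximal_ideal G \<I> by fact
  have prob: "fin_add_prob G \<B> \<mu>"
    and inv: "\<And>g B. g \<in> carrier G \<Longrightarrow> B \<in> \<B> \<Longrightarrow> \<mu> (g <# B) = \<mu> B"
    using \<mu> by (auto simp: left_invariant_prob_def)
  have AG: "A \<subseteq> carrier G" and EG: "E \<subseteq> carrier G" using A E in_carrier by auto
  \<comment> \<open>\<open>Q\<close> consists of the candidates allowed by \<open>Z\<close>; by
    assumption each of them gives a null intersection. Its complement is covered by right translates
    of \<open>A\<close>, which are small by stability.\<close>
  define Q where "Q = {x \<in> carrier G. \<forall>z\<in>Z. x \<otimes> z \<notin> A}"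
  have null: "\<mu> (E \<inter> (inv x <# A)) = 0" if "x \<in> Q" for x
    using none that prob_nonneg[OF prob, of "E \<inter> (inv x <# A)"] A E
    by (force simp: Q_def Int l_coset_closed)
  have small: "carrier G - Q \<in> \<I>"
  proof (rule I.subset_small)
    show "(\<Union>z\<in>Z. A #> inv z) \<in> \<I>"
      using Z A AG stable by (intro I.UN_small I.r_coset_small) auto
    show "carrier G - Q \<subseteq> (\<Union>z\<in>Z. A #> inv z)"
      using Z AG by (auto simp: Q_def mem_r_coset_iff subset_iff)
  qed
  have QG: "Q \<subseteq> carrier G" by (auto simp: Q_def)
  \<comment> \<open>Finitely many translates of the small complement of \<open>Q\<close> cannot
    cover the group. Iterating gives a sequence whose quotients
    \<open>inv (f m) \<otimes> f n\<close> for \<open>m < n\<close> all lie in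
    \<open>Q\<close>.\<close>
  have "\<exists>q\<in>carrier G. \<forall>p\<in>set h. inv p \<otimes> q \<in> Q" if h: "h \<in> lists (carrier G)" for h
  proof -
    have hG: "p \<in> carrier G" if "p \<in> set h" for p using that h by blast
    then have "(\<Union>p\<in>set h. p <# (carrier G - Q)) \<in> \<I>"
      using small by (intro I.UN_small I.l_coset_small) auto
    then have "carrier G \<noteq> (\<Union>p\<in>set h. p <# (carrier G - Q))"
      using I.carrier_not_small by metis
    moreover have "(\<Union>p\<in>set h. p <# (carrier G - Q)) \<subseteq> carrier G"
      using hG by (intro UN_least l_coset_subset_G) auto
    ultimately obtain q where q: "q \<in> carrier G" "q \<notin> (\<Union>p\<in>set h. p <# (carrier G - Q))"
      by blast
    have "inv p \<otimes> q \<in> Q" if "p \<in> set h" for p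
      using q that hG[OF that] by (auto simp: mem_l_coset_iff)
    then show ?thesis using q(1) by blast
  qed
  then obtain f :: "nat \<Rightarrow> 'a" where f: "\<And>n. f n \<in> carrier G"
      "\<And>n. \<forall>p\<in>set (map f [0..<n]). inv p \<otimes> f n \<in> Q"
    using history_choice[of "carrier G" "\<lambda>h q. \<forall>p\<in>set h. inv p \<otimes> q \<in> Q"] by metis
  \<comment> \<open>Translating by \<open>inv (f n)\<close> moves this overlap into
    \<open>E \<inter> (inv ?x <# A)\<close>, which is null because \<open>?x\<close> lies in
    \<open>Q\<close>.\<close>
  have less: "\<mu> ((f m <# E) \<inter> (f n <# E)) = 0" if "m < n" for m n
  proof -
    let ?x = "inv (f m) \<otimes> f n"
    have x: "?x \<in> Q" "?x \<in> carrier G" using f that by auto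
    have EB: "(f m <# E) \<inter> (f n <# E) \<in> \<B>" using f E by (intro Int l_coset_closed)
    then have "\<mu> ((f m <# E) \<inter> (f n <# E)) = \<mu> (inv (f n) <# ((f m <# E) \<inter> (f n <# E)))"
      using f by (simp add: inv)
    also have "\<dots> \<le> \<mu> (E \<inter> (inv ?x <# A))"
    proof (rule prob_mono[OF prob])
      show "inv (f n) <# ((f m <# E) \<inter> (f n <# E)) \<in> \<B>" using EB f by (intro l_coset_closed) auto
      show "E \<inter> (inv ?x <# A) \<in> \<B>" using E A x by (intro Int l_coset_closed) auto
      have eq: "inv (f n) <# (f n <# E) = E"
        using f EG by (simp add: lcos_m_assoc lcos_mult_one)
      have "inv (f n) <# (f m <# E) = inv ?x <# E"
        using f EG by (simp add: lcos_m_assoc inv_mult_group)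
      also have "\<dots> \<subseteq> inv ?x <# A" using E(2) by (auto simp: l_coset_def)
      finally show "inv (f n) <# ((f m <# E) \<inter> (f n <# E)) \<subseteq> E \<inter> (inv ?x <# A)"
        using eq by (auto simp: l_coset_def)
    qed
    also have "\<dots> = 0" by (rule null[OF x(1)])
    finally show ?thesis using prob_nonneg[OF prob EB] by simp
  qed
  \<comment> \<open>So many almost disjoint translates of \<open>E\<close> would have total measure
    above 1.\<close>
  obtain M :: nat where M: "1 < M * \<mu> E" using ex_less_of_nat_mult[OF E(3), of 1] by auto
  have fE: "f n <# E \<in> \<B>" for n using f E by (intro l_coset_closed)
  have disj: "\<mu> ((f m <# E) \<inter> (f n <# E)) = 0" if "m \<noteq> n" for m n
    using less[of m n] less[of n m] that by (cases "m < n") (auto simp: Int_commute)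
  have "\<mu> (\<Union>n\<in>{..<M}. f n <# E) = (\<Sum>n\<in>{..<M}. \<mu> (f n <# E))"
    by (rule prob_UN_almost_disjoint[OF prob]) (simp_all add: fE disj)
  also have "\<dots> = M * \<mu> E" using f E by (simp add: inv)
  finally have "1 < \<mu> (\<Union>n\<in>{..<M}. f n <# E)" using M by simp
  moreover have "(\<Union>n\<in>{..<M}. f n <# E) \<in> \<B>" using fE by (intro finite_UN) auto
  ultimately show False using prob_le_1[OF prob] by fastforce
qed

text \<open>A small \<open>A\<close> of positive measure would yield a half graph: each new
  \<open>x\<close> avoids \<open>A\<close> against all earlier \<open>y\<close>, yet keeps positive
  the measure of the set of \<open>y\<close> that still hit \<open>A\<close> against every
  \<open>x\<close> so far; the next \<open>y\<close> is taken from that set.\<close>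

lemma prob_small_null:
  assumes \<mu>: "left_invariant_prob G \<B> \<mu>" and I: "maximal_ideal G \<I>"
    and A: "A \<in> \<B>" "A \<in> \<I>"
  shows "\<mu> A = 0"
proof (rule ccontr)
  assume "\<mu> A \<noteq> 0"
  have prob: "fin_add_prob G \<B> \<mu>" using \<mu> by (simp add: left_invariant_prob_def)
  have pos: "\<mu> A > 0" using \<open>\<mu> A \<noteq> 0\<close> prob_nonneg[OF prob A(1)] by simp
  have AG: "A \<subseteq> carrier G" using A in_carrier by auto
  define E where "E h = A \<inter> {y \<in> carrier G. \<forall>(x, _)\<in>set h. x \<otimes> y \<in> A}" for h :: "('a \<times> 'a) list"
  \<comment> \<open>The requirement is vacuous when \<open>E h\<close> is null, so that every
    history has a continuation. Positivity along the actual sequence follows afterwards by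
    induction.\<close>
  define P where "P h s \<longleftrightarrow> (\<mu> (E h) > 0 \<longrightarrow> \<mu> (E (h @ [s])) > 0 \<and> snd s \<in> E (h @ [s]) \<and>
      (\<forall>(_, y)\<in>set h. fst s \<otimes> y \<notin> A))" for h s
  have E_snoc: "E (h @ [(x, y)]) = E h \<inter> (inv x <# A)" if "x \<in> carrier G" for h x y
    using that AG by (auto simp: E_def mem_l_coset_iff)
  have EB: "E h \<in> \<B>" if "h \<in> lists (carrier G \<times> carrier G)" for h
    using that
  proof (induction h rule: rev_induct)
    case Nil
    have "E [] = A" using AG by (auto simp: E_def)
    then show ?case using A by simp
  next
    case (snoc s h)
    obtain x y where s: "s = (x, y)" by (cases s)
    then have "x \<in> carrier G" "E h \<in> \<B>" using snoc by auto
    then show ?case using A by (simp add: s E_snoc Int l_coset_closed)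
  qed
  have step: "\<exists>s\<in>carrier G \<times> carrier G. P h s" if h: "h \<in> lists (carrier G \<times> carrier G)" for h
  proof (cases "\<mu> (E h) > 0")
    case True
    have "finite (snd ` set h)" "snd ` set h \<subseteq> carrier G" using h by auto
    then obtain x where x: "x \<in> carrier G" "\<forall>y\<in>snd ` set h. x \<otimes> y \<notin> A" "\<mu> (E h \<inter> (inv x <# A)) > 0"
      using positive_intersection_step[OF \<mu> I A EB[OF h] _ True, of "snd ` set h"] by (auto simp: E_def)
    then have "E h \<inter> (inv x <# A) \<noteq> {}" using prob_empty[OF prob] by auto
    then obtain y where y: "y \<in> E h \<inter> (inv x <# A)" by blast
    then have "y \<in> carrier G" by (simp add: E_def)
    moreover have "P h (x, y)" using x y by (force simp: P_def E_snoc)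
    ultimately show ?thesis using x by blast
  qed (auto simp: P_def intro!: bexI[of _ "(\<one>, \<one>)"])
  obtain f where f: "\<And>n. f n \<in> carrier G \<times> carrier G" "\<And>n. P (map f [0..<n]) (f n)"
    using history_choice[of "carrier G \<times> carrier G" P] step by metis
  have Epos: "\<mu> (E (map f [0..<n])) > 0" for n
  proof (induction n)
    case 0
    have "E [] = A" using AG by (auto simp: E_def)
    then show ?case using pos by simp
  next
    case (Suc n)
    then show ?case using f(2)[of n] by (simp add: P_def)
  qed
  define x y where xy: "x n = fst (f n)" "y n = snd (f n)" for n
  have f_eq: "f n = (x n, y n)" for n by (simp add: xy)
  have in_E: "y n \<in> E (map f [0..<n] @ [f n])" and out: "\<forall>(_, y')\<in>set (map f [0..<n]). x n \<otimes> y' \<notin> A" for n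
    using f(2)[of n] Epos[of n] by (simp_all add: P_def f_eq)
  have "x i \<otimes> y j \<in> A \<longleftrightarrow> i \<le> j" for i j
  proof (cases "i \<le> j")
    case True
    then have "f i \<in> set (map f [0..<j] @ [f j])" by (cases "i = j") auto
    then show ?thesis using in_E[of j] True by (force simp: E_def f_eq)
  next
    case False
    then have "f j \<in> set (map f [0..<i])" by auto
    then show ?thesis using out[of i] False by (force simp: f_eq)
  qed
  moreover have "range x \<subseteq> carrier G" "range y \<subseteq> carrier G" using f(1) by (auto simp: f_eq)
  ultimately show False
    using half_graph_free_le[OF stable_half_graph_free[OF stable[OF A(1)]], of x y] by blast
qed

section \<open>The approximating subgroup inside the algebra\<close>

lemma sym_diff_r_coset_small:
  assumes I: "maximal_ideal G \<I>" and E: "E \<in> \<B>"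
    and N: "subgroup N G" "finite (lcosets N)" and Y: "periodic N Y"
    and small: "sym_diff E Y \<in> \<I>" and g: "g \<in> carrier G"
  shows "sym_diff E Y #> g \<in> \<I>"
proof -
  interpret I: maximal_ideal G \<I> by fact
  have G: "E \<subseteq> carrier G" "Y \<subseteq> carrier G" using E in_carrier Y by (auto simp: periodic_def)
  \<comment> \<open>\<open>Y\<close> need not belong to \<open>\<B>\<close>, so stability of the
    symmetric difference is not at hand. Each half is a stable set cut by a periodic one, and right
    translation is applied to the halves.\<close>
  have "stable_in G (E \<inter> (carrier G - Y))"
    using stable_Int_periodic[OF N periodic_Diff[OF N(1) periodic_carrier[OF N(1)] Y] stable[OF E]] .
  moreover have "E \<inter> (carrier G - Y) = E - Y" using G by blast
  ultimately have 1: "stable_in G (E - Y)" by simp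
  have "stable_in G ((carrier G - E) \<inter> Y)"
    using stable_Int_periodic[OF N Y stable[OF compl_sets[OF E]]] .
  moreover have "(carrier G - E) \<inter> Y = Y - E" using G by blast
  ultimately have 2: "stable_in G (Y - E)" by simp
  have "E - Y \<in> \<I>" "Y - E \<in> \<I>" using small I.subset_small by blast+
  then have "(E - Y) #> g \<in> \<I>" "(Y - E) #> g \<in> \<I>"
    using I.r_coset_small[OF 1 _ g] I.r_coset_small[OF 2 _ g] G by blast+
  then have "((E - Y) #> g) \<union> ((Y - E) #> g) \<in> \<I>" by (rule I.Un_small)
  then show ?thesis by (rule I.subset_small) (auto simp: r_coset_def)
qed

text \<open>For finitely many \<open>z\<close>, a generic \<open>x\<close> in \<open>H\<close>
  satisfies \<open>x \<otimes> z \<in> E\<close> exactly when \<open>z \<in> H\<close>. Thus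
  sections of the stable set \<open>E\<close> approximate \<open>H\<close>, and definability
  exhibits \<open>H\<close> as a finite Boolean combination of translates of
  \<open>E\<close>.\<close>

lemma approximated_subgroup_in_algebra:
  assumes I: "maximal_ideal G \<I>" and E: "E \<in> \<B>"
    and H: "subgroup H G" "finite (lcosets H)" and small: "sym_diff E H \<in> \<I>"
  shows "H \<in> \<B>"
proof -
  interpret I: maximal_ideal G \<I> by fact
  interpret H: subgroup H G by fact
  have appr: "\<exists>x\<in>H. \<forall>z\<in>Z. x \<otimes> z \<in> E \<longleftrightarrow> z \<in> H" if Z: "finite Z" "Z \<subseteq> carrier G" for Z
  proof -
    have "(\<Union>z\<in>Z. sym_diff E H #> inv z) \<in> \<I>"
      using Z by (intro I.UN_small sym_diff_r_coset_small[OF I E H periodic_subgroup[OF H(1)] small]) auto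
    moreover have "H \<notin> \<I>"
    proof -
      have "\<one> <# H \<in> lcosets H" by (auto simp: LCOSETS_def)
      then show ?thesis using I.l_coset_not_small[OF H] H.subset by (simp add: lcos_mult_one)
    qed
    ultimately obtain x where x: "x \<in> H" "x \<notin> (\<Union>z\<in>Z. sym_diff E H #> inv z)"
      using I.subset_small by blast
    have "x \<otimes> z \<in> E \<longleftrightarrow> z \<in> H" if z: "z \<in> Z" for z
    proof -
      have zG: "z \<in> carrier G" using z Z by auto
      have "x \<notin> sym_diff E H #> inv z" using x z by blast
      moreover have "sym_diff E H \<subseteq> carrier G" using in_carrier[OF E] H.subset by blast
      ultimately have "x \<otimes> z \<notin> sym_diff E H" using x(1) zG by (simp add: mem_r_coset_iff)
      then have "x \<otimes> z \<in> E \<longleftrightarrow> x \<otimes> z \<in> H" by blast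
      also have "\<dots> \<longleftrightarrow> z \<in> H"
      proof
        assume "x \<otimes> z \<in> H"
        then have "inv x \<otimes> (x \<otimes> z) \<in> H" using x(1) by simp
        then show "z \<in> H" using x(1) zG by (simp add: m_assoc[symmetric])
      qed (use x in simp)
      finally show ?thesis .
    qed
    then show ?thesis using x(1) by blast
  qed
  have "half_graph_free (\<lambda>x y. x \<otimes> y \<in> E) H (carrier G)"
    using half_graph_free_mono[OF stable_half_graph_free[OF stable[OF E]]] H.subset by blast
  from definability[OF this appr] obtain F where F: "finite F" "F \<subseteq> H"
    and det: "\<And>y z. y \<in> carrier G \<Longrightarrow> z \<in> carrier G \<Longrightarrow> (\<forall>x\<in>F. x \<otimes> y \<in> E \<longleftrightarrow> x \<otimes> z \<in> E) \<Longrightarrow>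
      y \<in> H \<longleftrightarrow> z \<in> H"
    by blast
  \<comment> \<open>\<open>cell T\<close> gathers the elements with one prescribed pattern against
    \<open>F\<close>; \<open>H\<close> is the union of the cells of the patterns that it
    realises.\<close>
  define cell where "cell T = {y \<in> carrier G. \<forall>x\<in>F. x \<otimes> y \<in> E \<longleftrightarrow> x \<in> T}" for T
  have cell: "cell T \<in> \<B>" for T
    unfolding cell_def
  proof (rule sets_Collect_finite_All[OF _ F(1)])
    fix x assume "x \<in> F"
    then have xG: "x \<in> carrier G" using F by auto
    have "{y \<in> carrier G. x \<otimes> y \<in> E} = inv x <# E"
      using xG in_carrier[OF E] by (auto simp: mem_l_coset_iff)
    moreover have "{y \<in> carrier G. x \<otimes> y \<notin> E} = carrier G - (inv x <# E)"
      using xG in_carrier[OF E] by (auto simp: mem_l_coset_iff)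
    moreover have "inv x <# E \<in> \<B>" using xG E by (simp add: l_coset_closed)
    ultimately show "{y \<in> carrier G. x \<otimes> y \<in> E \<longleftrightarrow> x \<in> T} \<in> \<B>"
      by (cases "x \<in> T") (auto intro: compl_sets)
  qed
  let ?T = "(\<lambda>y. {x \<in> F. x \<otimes> y \<in> E}) ` H"
  have "finite ?T" by (rule finite_subset[of _ "Pow F"]) (auto simp: F)
  then have "(\<Union>T\<in>?T. cell T) \<in> \<B>" using cell by (intro finite_UN) auto
  moreover have "(\<Union>T\<in>?T. cell T) = H"
  proof
    show "H \<subseteq> (\<Union>T\<in>?T. cell T)" by (auto simp: cell_def)
    show "(\<Union>T\<in>?T. cell T) \<subseteq> H"
    proof
      fix y assume "y \<in> (\<Union>T\<in>?T. cell T)"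
      then obtain z where z: "z \<in> H" "y \<in> cell {x \<in> F. x \<otimes> z \<in> E}" by blast
      then show "y \<in> H" using det[of y z] by (auto simp: cell_def)
    qed
  qed
  ultimately show ?thesis by simp
qed

text \<open>The periodic sets that agree with a member of \<open>\<B>\<close> up to a small set form a finite
  left-invariant algebra; its atom at \<open>\<one>\<close> is the subgroup.\<close>

lemma coset_approximation:
  assumes I: "maximal_ideal G \<I>" and A: "A \<in> \<B>"
  shows "\<exists>H \<D>. subgroup H G \<and> finite (lcosets H) \<and> H \<in> \<B> \<and> \<D> \<subseteq> lcosets H \<and>
    sym_diff A (\<Union>\<D>) \<in> \<I> \<and> (bi_invariant_sets G \<B> \<longrightarrow> H \<lhd> G)"
proof -
  interpret I: maximal_ideal G \<I> by fact
  obtain N Y where N: "N \<lhd> G" "finite (lcosets N)" and Y: "periodic N Y" "sym_diff A Y \<in> \<I>"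
    using I.periodic_approximation[OF stable[OF A] in_carrier[OF A]] by blast
  interpret N: normal N G by fact
  have sub: "subgroup N G" by (rule N.subgroup_axioms)
  define \<Y> where "\<Y> = {Z. periodic N Z \<and> (\<exists>E\<in>\<B>. sym_diff E Z \<in> \<I>)}"
  have \<Y>_Int: "Z \<inter> W \<in> \<Y>" and \<Y>_Diff: "Z - W \<in> \<Y>" if ZW: "Z \<in> \<Y>" "W \<in> \<Y>" for Z W
  proof -
    obtain D E where DE: "D \<in> \<B>" "E \<in> \<B>" "sym_diff D Z \<in> \<I>" "sym_diff E W \<in> \<I>"
      and per: "periodic N Z" "periodic N W"
      using ZW by (auto simp: \<Y>_def)
    have "sym_diff D Z \<union> sym_diff E W \<in> \<I>" by (rule I.Un_small[OF DE(3,4)])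
    then have "sym_diff (D \<inter> E) (Z \<inter> W) \<in> \<I>" "sym_diff (D - E) (Z - W) \<in> \<I>"
      by (rule I.subset_small, blast)+
    moreover have "D \<inter> E \<in> \<B>" "D - E \<in> \<B>" using DE by auto
    ultimately show "Z \<inter> W \<in> \<Y>" "Z - W \<in> \<Y>"
      using periodic_Int[OF per] periodic_Diff[OF sub per] unfolding \<Y>_def by blast+
  qed
  have \<Y>_l: "g <# Z \<in> \<Y>" if Z: "Z \<in> \<Y>" and g: "g \<in> carrier G" for g Z
  proof -
    obtain E where E: "E \<in> \<B>" "sym_diff E Z \<in> \<I>" and per: "periodic N Z" using Z by (auto simp: \<Y>_def)
    have "sym_diff (g <# E) (g <# Z) \<in> \<I>"
      using I.l_coset_small[OF g E(2)] sym_diff_l_coset by (rule I.subset_small)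
    then show ?thesis
      using periodic_l_coset[OF sub per g] l_coset_closed[OF g E(1)] unfolding \<Y>_def by blast
  qed
  have \<Y>_r: "Z #> g \<in> \<Y>" if bi: "bi_invariant_sets G \<B>" and Z: "Z \<in> \<Y>" and g: "g \<in> carrier G" for g Z
  proof -
    obtain E where E: "E \<in> \<B>" "sym_diff E Z \<in> \<I>" and per: "periodic N Z" using Z by (auto simp: \<Y>_def)
    have ZG: "Z \<subseteq> carrier G" using per by (simp add: periodic_def)
    have "periodic N (Z #> g)"
      unfolding periodic_def
    proof (intro conjI ballI)
      show "Z #> g \<subseteq> carrier G" using ZG g by (simp add: r_coset_subset_G)
      fix y n assume y: "y \<in> Z #> g" and n: "n \<in> N"
      then obtain z where z: "z \<in> Z" "y = z \<otimes> g" by (auto simp: r_coset_def)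
      have G: "z \<in> carrier G" "n \<in> carrier G" using z ZG n N.mem_carrier by auto
      \<comment> \<open>Normality of \<open>N\<close> lets \<open>n\<close> pass to the left of
        \<open>g\<close> as a conjugate, which \<open>Z\<close> absorbs.\<close>
      have "y \<otimes> n = z \<otimes> (g \<otimes> n \<otimes> inv g) \<otimes> g" using z G g by (simp add: m_assoc)
      moreover have "z \<otimes> (g \<otimes> n \<otimes> inv g) \<in> Z"
        using per z N.inv_op_closed2[OF g n] by (simp add: periodic_def)
      ultimately show "y \<otimes> n \<in> Z #> g" by (auto simp: r_coset_def)
    qed
    moreover have "sym_diff (E #> g) (Z #> g) \<in> \<I>"
      using sym_diff_r_coset_small[OF I E(1) sub N(2) per E(2) g]
      by (rule I.subset_small) (unfold r_coset_def, blast)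
    moreover have "E #> g \<in> \<B>" using bi E g by (auto simp: bi_invariant_sets_def)
    ultimately show ?thesis unfolding \<Y>_def by blast
  qed
  have \<Y>_carrier: "carrier G \<in> \<Y>"
    using periodic_carrier[OF sub] I.empty_small unfolding \<Y>_def by (auto intro!: bexI[of _ "carrier G"])
  have \<Y>_Y: "Y \<in> \<Y>" using Y A by (auto simp: \<Y>_def)
  have \<Y>_per: "periodic N Z" if "Z \<in> \<Y>" for Z using that by (simp add: \<Y>_def)
  \<comment> \<open>Finiteness of the coset space bounds \<open>\<Y>\<close>, so the intersection
    defining \<open>H\<close> is finite and stays in \<open>\<Y>\<close>.\<close>
  have "\<Y> \<subseteq> Union ` Pow (lcosets N)"
    using periodic_eq_Union[OF sub \<Y>_per] by blast
  then have fin: "finite \<Y>" using N(2) by (meson finite_Pow_iff finite_imageI finite_subset)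
  define H where "H = \<Inter>{Z \<in> \<Y>. \<one> \<in> Z}"
  have Inter: "\<Inter>\<Z> \<in> \<Y>" if "finite \<Z>" "\<Z> \<noteq> {}" "\<Z> \<subseteq> \<Y>" for \<Z>
    using that by (induction \<Z> rule: finite_ne_induct) (auto intro: \<Y>_Int)
  have H\<Y>: "H \<in> \<Y>"
    unfolding H_def using fin \<Y>_carrier by (intro Inter) auto
  have one: "\<one> \<in> H" by (auto simp: H_def)
  have least: "H \<subseteq> Z" if "Z \<in> \<Y>" "\<one> \<in> Z" for Z using that by (auto simp: H_def)
  have \<Y>G: "Z \<subseteq> carrier G" if "Z \<in> \<Y>" for Z using \<Y>_per[OF that] by (simp add: periodic_def)
  have HG: "H \<subseteq> carrier G" by (rule \<Y>G[OF H\<Y>])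
  \<comment> \<open>The translate \<open>inv z <# Z\<close> is a member through
    \<open>\<one>\<close>, hence contains \<open>H\<close>. So every member of \<open>\<Y>\<close>
    is a union of left cosets of \<open>H\<close>.\<close>
  have coset: "z <# H \<subseteq> Z" if Z: "Z \<in> \<Y>" and z: "z \<in> Z" for z Z
  proof -
    have zG: "z \<in> carrier G" using \<Y>G Z z by blast
    have "\<one> \<in> inv z <# Z" using \<Y>G[OF Z] z zG by (simp add: mem_l_coset_iff)
    then have "H \<subseteq> inv z <# Z" using least[OF \<Y>_l[OF Z inv_closed[OF zG]]] by blast
    then show ?thesis using \<Y>G[OF Z] zG HG by (auto simp: l_coset_def[of _ z H] mem_l_coset_iff)
  qed
  have H_sub: "subgroup H G"
  proof (rule subgroupI)
    show "H \<subseteq> carrier G" "H \<noteq> {}" using HG one by auto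
    show "h \<otimes> k \<in> H" if "h \<in> H" "k \<in> H" for h k
      using coset[OF H\<Y> \<open>h \<in> H\<close>] that by (auto simp: l_coset_def)
    show "inv h \<in> H" if h: "h \<in> H" for h
    proof (rule ccontr)
      assume "inv h \<notin> H"
      have hG: "h \<in> carrier G" using h HG by auto
      \<comment> \<open>Otherwise \<open>H - (h <# H)\<close> would be a member through
        \<open>\<one>\<close> that omits \<open>h\<close>, against minimality of
        \<open>H\<close>.\<close>
      then have "\<one> \<in> H - (h <# H)" using one \<open>inv h \<notin> H\<close> HG by (simp add: mem_l_coset_iff)
      then have "H \<subseteq> H - (h <# H)" using least[OF \<Y>_Diff[OF H\<Y> \<Y>_l[OF H\<Y> hG]]] by blast
      moreover have "h \<in> h <# H" using one hG HG by (simp add: mem_l_coset_iff)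
      ultimately show False using h by blast
    qed
  qed
  have "N \<subseteq> H"
  proof
    fix n assume n: "n \<in> N"
    then have "\<one> \<otimes> n \<in> H" using \<Y>_per[OF H\<Y>] one unfolding periodic_def by blast
    then show "n \<in> H" using n N.mem_carrier by simp
  qed
  then have H_fin: "finite (lcosets H)" using finite_lcosets_mono[OF sub H_sub] N(2) by blast
  obtain E where E: "E \<in> \<B>" "sym_diff E H \<in> \<I>" using H\<Y> by (auto simp: \<Y>_def)
  have H_in: "H \<in> \<B>" by (rule approximated_subgroup_in_algebra[OF I E(1) H_sub H_fin E(2)])
  have "periodic H Y"
    using coset[OF \<Y>_Y] Y(1) by (auto simp: periodic_def l_coset_def)
  then have Y_eq: "Y = \<Union>{C \<in> lcosets H. C \<subseteq> Y}" by (rule periodic_eq_Union[OF H_sub])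
  have "H \<lhd> G" if bi: "bi_invariant_sets G \<B>"
  proof (rule normal_invI[OF H_sub])
    fix x h assume x: "x \<in> carrier G" and h: "h \<in> H"
    have hG: "h \<in> carrier G" using h HG by auto
    \<comment> \<open>Under bi-invariance each conjugate of \<open>H\<close> is a member through
      \<open>\<one>\<close>, so it contains \<open>H\<close>.\<close>
    let ?Z = "inv x <# H #> x"
    have xH: "inv x <# H \<subseteq> carrier G" using x HG by (simp add: l_coset_subset_G)
    have "?Z \<in> \<Y>" using \<Y>_r[OF bi \<Y>_l[OF H\<Y> inv_closed[OF x]] x] .
    moreover have "\<one> \<in> ?Z" using x xH one HG by (simp add: mem_r_coset_iff mem_l_coset_iff)
    ultimately have "h \<in> ?Z" using least h by blast
    then show "x \<otimes> h \<otimes> inv x \<in> H"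
      using x xH HG hG by (simp add: mem_r_coset_iff mem_l_coset_iff m_assoc)
  qed
  then show ?thesis
    using H_sub H_fin H_in Y(2) Y_eq
    by (intro exI[of _ H] exI[of _ "{C \<in> lcosets H. C \<subseteq> Y}"]) auto
qed

section \<open>Positivity, uniqueness and existence of the invariant measure\<close>

lemma some_maximal_ideal: "\<exists>\<I>. maximal_ideal G \<I>"
proof -
  have "\<not> generic_in G {}" by (auto simp: generic_in_def set_mult_def)
  then show ?thesis using maximal_ideal_exists[of "{}"] by blast
qed

text \<open>A non-generic set lies in some maximal ideal, chosen depending on the set, and is
  therefore null.\<close>

lemma prob_pos_iff_generic:
  assumes \<mu>: "left_invariant_prob G \<B> \<mu>" and A: "A \<in> \<B>"
  shows "\<mu> A > 0 \<longleftrightarrow> generic_in G A"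
proof
  assume pos: "\<mu> A > 0"
  show "generic_in G A"
  proof (rule ccontr)
    assume "\<not> generic_in G A"
    then obtain \<I> where "maximal_ideal G \<I>" "A \<in> \<I>"
      using maximal_ideal_exists[OF in_carrier[OF A]] by blast
    then show False using prob_small_null[OF \<mu> _ A] pos by fastforce
  qed
qed (rule prob_generic_pos[OF \<mu> A])

text \<open>\<open>H\<close> and \<open>Y\<close> come from one ideal and do not depend on
  \<open>\<mu>\<close>. Uniqueness relies on this order of quantifiers: two measures get the same
  counting value.\<close>

lemma coset_approx_exists:
  assumes A: "A \<in> \<B>"
  shows "\<exists>H Y. (\<forall>\<mu>. left_invariant_prob G \<B> \<mu> \<longrightarrow> coset_approx G \<B> \<mu> A H Y) \<and>
    (bi_invariant_sets G \<B> \<longrightarrow> H \<lhd> G)"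
proof -
  obtain \<I> where I: "maximal_ideal G \<I>" using some_maximal_ideal by blast
  obtain H \<D> where H: "subgroup H G" "finite (lcosets H)" "H \<in> \<B>" "\<D> \<subseteq> lcosets H"
    and small: "sym_diff A (\<Union>\<D>) \<in> \<I>" and normal: "bi_invariant_sets G \<B> \<longrightarrow> H \<lhd> G"
    using coset_approximation[OF I A] by blast
  have "coset_approx G \<B> \<mu> A H (\<Union>\<D>)" if \<mu>: "left_invariant_prob G \<B> \<mu>" for \<mu>
  proof -
    have "sym_diff A (\<Union>\<D>) \<in> \<B>"
      by (rule sym_diff_closed[OF A prob_coset_union(1)[OF \<mu> H]])
    then have "\<mu> (sym_diff A (\<Union>\<D>)) = 0" using prob_small_null[OF \<mu> I _ small] by blast
    then show ?thesis using H unfolding coset_approx_def by blast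
  qed
  then show ?thesis using normal by blast
qed

lemma coset_approx_value:
  assumes \<mu>: "left_invariant_prob G \<B> \<mu>" and A: "A \<in> \<B>" and appr: "coset_approx G \<B> \<mu> A H Y"
  shows "\<mu> A = \<mu> Y"
    and "\<mu> Y = real (card {C \<in> lcosets H. C \<subseteq> Y}) / real (card (lcosets H))"
proof -
  obtain \<D> where H: "subgroup H G" "finite (lcosets H)" "H \<in> \<B>" "\<D> \<subseteq> lcosets H"
    and Y: "Y = \<Union>\<D>" "\<mu> (sym_diff A Y) = 0"
    using appr by (auto simp: coset_approx_def)
  have prob: "fin_add_prob G \<B> \<mu>" using \<mu> by (simp add: left_invariant_prob_def)
  show "\<mu> A = \<mu> Y"
    using prob_eq_of_sym_diff_null[OF prob A _ Y(2)] prob_coset_union(1)[OF \<mu> H] Y(1) by simp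
  show "\<mu> Y = real (card {C \<in> lcosets H. C \<subseteq> Y}) / real (card (lcosets H))"
    using prob_coset_union(2)[OF \<mu> H] Y(1) by simp
qed

lemma left_invariant_prob_unique:
  assumes \<mu>: "left_invariant_prob G \<B> \<mu>" and \<nu>: "left_invariant_prob G \<B> \<nu>"
  shows "\<mu> = \<nu>"
proof (rule PiE_ext)
  show "\<mu> \<in> \<B> \<rightarrow>\<^sub>E {0..1}" "\<nu> \<in> \<B> \<rightarrow>\<^sub>E {0..1}"
    using \<mu> \<nu> by (simp_all add: left_invariant_prob_def fin_add_prob_def)
  fix A assume A: "A \<in> \<B>"
  obtain H Y where HY: "\<And>\<mu>. left_invariant_prob G \<B> \<mu> \<Longrightarrow> coset_approx G \<B> \<mu> A H Y"
    using coset_approx_exists[OF A] by blast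
  show "\<mu> A = \<nu> A"
    using coset_approx_value[OF \<mu> A HY[OF \<mu>]] coset_approx_value[OF \<nu> A HY[OF \<nu>]] by linarith
qed

text \<open>For one fixed ideal, the measure of \<open>A\<close> is the density of any periodic set
  approximating it. Two approximations are compared over the intersection of their subgroups, where
  the periodic sets coincide.\<close>

lemma left_invariant_prob_exists: "\<exists>\<mu>. left_invariant_prob G \<B> \<mu>"
proof -
  obtain \<I> where "maximal_ideal G \<I>" using some_maximal_ideal by blast
  then interpret I: maximal_ideal G \<I> .
  define app where "app N Y A \<longleftrightarrow>
      N \<lhd> G \<and> finite (lcosets N) \<and> periodic N Y \<and> sym_diff A Y \<in> \<I>" for N Y A
  have app_exists: "\<exists>N Y. app N Y A" if "A \<in> \<B>" for A
    using I.periodic_approximation[OF stable[OF that] in_carrier[OF that]] by (simp add: app_def)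
  have app_refine: "app (M \<inter> N) Y A" "coset_density (M \<inter> N) Y = coset_density M Y"
    if MY: "app M Y A" and N: "N \<lhd> G" "finite (lcosets N)" for M N Y A
  proof -
    have sub: "subgroup M G" "subgroup N G" using MY N by (auto simp: app_def normal_imp_subgroup)
    have fin: "finite (lcosets (M \<inter> N))"
      using finite_lcosets_Int[OF sub] MY N by (simp add: app_def)
    show "app (M \<inter> N) Y A"
      using MY N fin normal_subgroup_intersect periodic_mono[of M Y "M \<inter> N"] by (simp add: app_def)
    show "coset_density (M \<inter> N) Y = coset_density M Y"
      using MY fin by (intro coset_density_refine subgroups_Inter_pair sub) (auto simp: app_def)
  qed
  have app_eq: "Y = Z" if Y: "app N Y A" and Z: "app N Z A" for N Y Z A
  proof -
    have per: "periodic N Y" "periodic N Z" and N: "subgroup N G" "finite (lcosets N)"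
      using Y Z by (auto simp: app_def normal_imp_subgroup)
    have "sym_diff A Y \<union> sym_diff A Z \<in> \<I>" 
      using I.Un_small[of "sym_diff A Y" "sym_diff A Z"] Y Z by (simp add: app_def)
    then have "Y - Z \<in> \<I>" "Z - Y \<in> \<I>" by (rule I.subset_small, blast)+
    then have "Y - Z = {}" "Z - Y = {}"
      using I.periodic_small_empty[OF N] periodic_Diff[OF N(1)] per by blast+
    then show ?thesis by blast
  qed
  have indep: "coset_density M Y = coset_density N Z" if Y: "app M Y A" and Z: "app N Z A" for M N Y Z A
  proof -
    have MN: "M \<lhd> G" "finite (lcosets M)" "N \<lhd> G" "finite (lcosets N)" using Y Z by (simp_all add: app_def)
    have "app (M \<inter> N) Z A"
      using app_refine(1)[OF Z MN(1,2)] by (simp add: Int_commute)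
    with app_refine(1)[OF Y MN(3,4)] have "Y = Z" by (rule app_eq)
    then show ?thesis
      using app_refine(2)[OF Y MN(3,4)] app_refine(2)[OF Z MN(1,2)] by (simp add: Int_commute)
  qed
  \<comment> \<open>The choice of \<open>d\<close> is harmless by \<open>indep\<close>.\<close>
  define \<mu> where "\<mu> = (\<lambda>A\<in>\<B>. SOME d. \<exists>N Y. app N Y A \<and> d = coset_density N Y)"
  have \<mu>_eq: "\<mu> A = coset_density N Y" if A: "A \<in> \<B>" and "app N Y A" for A N Y
  proof -
    have "\<exists>N Y. app N Y A \<and> \<mu> A = coset_density N Y"
      unfolding \<mu>_def restrict_apply'[OF A] by (rule someI_ex) (use that in blast)
    then show ?thesis using indep[OF _ that(2)] by metis
  qed
  have "fin_add_prob G \<B> \<mu>"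
    unfolding fin_add_prob_def
  proof (intro conjI PiE_I)
    fix A assume A: "A \<in> \<B>"
    then obtain N Y where "app N Y A" using app_exists by blast
    then show "\<mu> A \<in> {0..1}"
      using \<mu>_eq[OF A] coset_density_bounds[of N Y] by (simp add: app_def)
  next
    show "\<mu> A = undefined" if "A \<notin> \<B>" for A using that by (simp add: \<mu>_def)
  next
    show "Measure_Space.additive \<B> \<mu>"
      unfolding Measure_Space.additive_def
    proof (intro ballI impI)
      fix A B assume A: "A \<in> \<B>" and B: "B \<in> \<B>" and disj: "A \<inter> B = {}"
      obtain M Y where M: "app M Y A" using app_exists[OF A] by blast
      obtain N Z where N: "app N Z B" using app_exists[OF B] by blast
      let ?K = "M \<inter> N"
      have K: "app ?K Y A" "app ?K Z B"
      proof -
        have normal: "M \<lhd> G" "finite (lcosets M)" "N \<lhd> G" "finite (lcosets N)"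
          using M N by (simp_all add: app_def)
        show "app ?K Y A" by (rule app_refine(1)[OF M normal(3,4)])
        show "app ?K Z B" using app_refine(1)[OF N normal(1,2)] by (simp only: Int_commute)
      qed
      then have per: "periodic ?K Y" "periodic ?K Z" and sub: "subgroup ?K G" "finite (lcosets ?K)"
        by (auto simp: app_def normal_imp_subgroup)
      have small: "sym_diff A Y \<union> sym_diff B Z \<in> \<I>"
        using I.Un_small[of "sym_diff A Y" "sym_diff B Z"] K by (simp add: app_def)
      \<comment> \<open>Disjoint sets have almost disjoint approximations, and a small periodic set
        is empty.\<close>
      then have "Y \<inter> Z \<in> \<I>" by (rule I.subset_small) (use disj in blast)
      then have YZ: "Y \<inter> Z = {}" using I.periodic_small_empty[OF sub periodic_Int[OF per]] by blast
      have "sym_diff (A \<union> B) (Y \<union> Z) \<in> \<I>" using small by (rule I.subset_small) blast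
      then have "app ?K (Y \<union> Z) (A \<union> B)" using K periodic_Un[OF per] by (simp add: app_def)
      then have "\<mu> (A \<union> B) = coset_density ?K (Y \<union> Z)" using A B by (intro \<mu>_eq) auto
      also have "\<dots> = \<mu> A + \<mu> B"
        using coset_density_Un[OF sub per YZ] \<mu>_eq[OF A K(1)] \<mu>_eq[OF B K(2)] by simp
      finally show "\<mu> (A \<union> B) = \<mu> A + \<mu> B" .
    qed
  next
    \<comment> \<open>The empty set merely supplies some \<open>N\<close>, over which the whole
      group approximates itself.\<close>
    obtain N Y where N: "app N Y {}" using app_exists[of "{}"] by blast
    then have sub: "subgroup N G" "finite (lcosets N)" by (auto simp: app_def normal_imp_subgroup)
    have "app N (carrier G) (carrier G)"
      using N sub I.empty_small by (simp add: app_def periodic_carrier)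
    then show "\<mu> (carrier G) = 1"
      using \<mu>_eq[of "carrier G"] coset_density_carrier[OF sub] by simp
  qed
  moreover have "\<mu> (g <# A) = \<mu> A" if g: "g \<in> carrier G" and A: "A \<in> \<B>" for g A
  proof -
    obtain N Y where N: "app N Y A" using app_exists[OF A] by blast
    then have sub: "subgroup N G" and per: "periodic N Y" by (auto simp: app_def normal_imp_subgroup)
    have "g <# sym_diff A Y \<in> \<I>" using N g by (simp add: app_def I.l_coset_small)
    then have "sym_diff (g <# A) (g <# Y) \<in> \<I>" using sym_diff_l_coset by (rule I.subset_small)
    then have "app N (g <# Y) (g <# A)" using N periodic_l_coset[OF sub per g] by (simp add: app_def)
    then have "\<mu> (g <# A) = coset_density N (g <# Y)" using l_coset_closed[OF g A] by (intro \<mu>_eq)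
    also have "\<dots> = \<mu> A"
      using coset_density_l_coset[OF sub _ g] per \<mu>_eq[OF A N] by (simp add: periodic_def)
    finally show ?thesis .
  qed
  ultimately show ?thesis unfolding left_invariant_prob_def by blast
qed

section \<open>Bi-invariant algebras and right-invariant measures\<close>

lemma r_coset_prob:
  assumes bi: "bi_invariant_sets G \<B>" and \<mu>: "left_invariant_prob G \<B> \<mu>" and g: "g \<in> carrier G"
  shows "left_invariant_prob G \<B> (\<lambda>A\<in>\<B>. \<mu> (A #> g))"
proof -
  have prob: "fin_add_prob G \<B> \<mu>" using \<mu> by (simp add: left_invariant_prob_def)
  have cl: "A #> g \<in> \<B>" if "A \<in> \<B>" for A using bi g that by (auto simp: bi_invariant_sets_def)
  have "\<mu> ((A \<union> B) #> g) = \<mu> (A #> g) + \<mu> (B #> g)" if AB: "A \<in> \<B>" "B \<in> \<B>" "A \<inter> B = {}" for A B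
  proof -
    have "(A #> g) \<inter> (B #> g) = {}"
      using AB g in_carrier[of A] in_carrier[of B] by (auto simp: mem_r_coset_iff)
    moreover have "(A \<union> B) #> g = (A #> g) \<union> (B #> g)" by (auto simp: r_coset_def)
    ultimately show ?thesis using prob_Un[OF prob] cl AB by simp
  qed
  moreover have "carrier G #> g = carrier G" using g by (auto simp: mem_r_coset_iff)
  moreover have "\<mu> ((h <# A) #> g) = \<mu> (A #> g)" if "h \<in> carrier G" "A \<in> \<B>" for h A
  proof -
    have "(h <# A) #> g = h <# (A #> g)" using that g in_carrier[of A] by (simp add: coset_assoc)
    then show ?thesis using \<mu> that cl by (simp add: left_invariant_prob_def)
  qed
  ultimately show ?thesis
    using prob_nonneg[OF prob] prob_le_1[OF prob] prob_carrier[OF prob] cl l_coset_closed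
    by (simp add: left_invariant_prob_def fin_add_prob_def Measure_Space.additive_def Un)
qed

text \<open>For fixed \<open>g\<close>, sending \<open>A\<close> to \<open>\<mu> (A #> g)\<close>
  gives another left-invariant probability, which by uniqueness is \<open>\<mu>\<close>.\<close>

lemma left_invariant_prob_bi_invariant:
  assumes bi: "bi_invariant_sets G \<B>" and \<mu>: "left_invariant_prob G \<B> \<mu>"
  shows "bi_invariant_prob G \<B> \<mu>"
proof -
  have "\<mu> (A #> g) = \<mu> A" if g: "g \<in> carrier G" and A: "A \<in> \<B>" for g A
    using fun_cong[OF left_invariant_prob_unique[OF r_coset_prob[OF bi \<mu> g] \<mu>], of A] A by simp
  then show ?thesis
    using \<mu> by (simp add: bi_invariant_prob_def right_invariant_prob_def left_invariant_prob_def)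
qed

lemma set_inv_l_coset:
  assumes "A \<subseteq> carrier G" "g \<in> carrier G"
  shows "set_inv (g <# A) = set_inv A #> inv g"
  using assms by (force simp: SET_INV_def l_coset_def r_coset_def inv_mult_group subset_iff)

text \<open>The algebra of inverses exchanges left and right translation; this carries the results
  on left-invariant measures over to right-invariant ones.\<close>

lemma stable_algebra_set_inv:
  assumes bi: "bi_invariant_sets G \<B>"
  shows "stable_algebra G {A. A \<subseteq> carrier G \<and> set_inv A \<in> \<B>}" (is "stable_algebra G ?B")
proof -
  have "algebra (carrier G) ?B"
    unfolding algebra_iff_Un
  proof (intro conjI ballI)
    show "?B \<subseteq> Pow (carrier G)" by blast
    show "{} \<in> ?B" by (simp add: SET_INV_def)
    show "carrier G - A \<in> ?B" if "A \<in> ?B" for A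
    proof -
      have "set_inv (carrier G - A) = carrier G - set_inv A"
        using that by (auto simp: mem_set_inv_iff)
      then show ?thesis using that compl_sets by auto
    qed
    show "A \<union> B \<in> ?B" if "A \<in> ?B" "B \<in> ?B" for A B
    proof -
      have "set_inv (A \<union> B) = set_inv A \<union> set_inv B" by (auto simp: SET_INV_def)
      then show ?thesis using that by auto
    qed
  qed
  moreover have "g <# A \<in> ?B" if "g \<in> carrier G" "A \<in> ?B" for g A
    using that bi by (auto simp: set_inv_l_coset bi_invariant_sets_def l_coset_subset_G)
  moreover have "stable_in G A" if "A \<in> ?B" for A
    using that stable_set_inv[OF stable, of "set_inv A"] by (simp add: set_inv_set_inv set_inv_subset)
  ultimately show ?thesis
    by (intro stable_algebra.intro left_invariant_algebra.intro left_invariant_algebra_axioms.intro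
        stable_algebra_axioms.intro is_group) auto
qed

lemma right_invariant_prob_set_inv:
  assumes bi: "bi_invariant_sets G \<B>" and \<nu>: "right_invariant_prob G \<B> \<nu>"
  defines "\<B>' \<equiv> {A. A \<subseteq> carrier G \<and> set_inv A \<in> \<B>}"
  shows "left_invariant_prob G \<B>' (\<lambda>A\<in>\<B>'. \<nu> (set_inv A))"
proof -
  interpret B': stable_algebra G \<B>' unfolding \<B>'_def by (rule stable_algebra_set_inv[OF bi])
  have prob: "fin_add_prob G \<B> \<nu>" using \<nu> by (simp add: right_invariant_prob_def)
  have "\<nu> (set_inv (A \<union> B)) = \<nu> (set_inv A) + \<nu> (set_inv B)"
    if AB: "A \<in> \<B>'" "B \<in> \<B>'" "A \<inter> B = {}" for A B
  proof -
    have "set_inv A \<inter> set_inv B = {}" using AB by (auto simp: \<B>'_def mem_set_inv_iff)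
    moreover have "set_inv (A \<union> B) = set_inv A \<union> set_inv B" by (auto simp: SET_INV_def)
    ultimately show ?thesis using prob_Un[OF prob] AB by (simp add: \<B>'_def)
  qed
  moreover have "set_inv (carrier G) = carrier G" by (auto simp: mem_set_inv_iff)
  moreover have "\<nu> (set_inv (g <# A)) = \<nu> (set_inv A)" if "g \<in> carrier G" "A \<in> \<B>'" for g A
    using that \<nu> by (simp add: \<B>'_def set_inv_l_coset right_invariant_prob_def)
  moreover have "0 \<le> \<nu> (set_inv A)" "\<nu> (set_inv A) \<le> 1" if "A \<in> \<B>'" for A
    using that prob_nonneg[OF prob] prob_le_1[OF prob] by (simp_all add: \<B>'_def)
  ultimately show ?thesis
    using prob_carrier[OF prob] B'.l_coset_closed
    by (simp add: left_invariant_prob_def fin_add_prob_def Measure_Space.additive_def B'.Un)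
qed

text \<open>\<open>\<mu>\<close> is itself right-invariant. Composed with inversion, both measures
  become left-invariant on the algebra of inverses, where uniqueness identifies them.\<close>

lemma right_invariant_prob_eq:
  assumes bi: "bi_invariant_sets G \<B>" and \<mu>: "left_invariant_prob G \<B> \<mu>"
    and \<nu>: "right_invariant_prob G \<B> \<nu>"
  shows "\<nu> = \<mu>"
proof (rule PiE_ext)
  let ?B = "{A. A \<subseteq> carrier G \<and> set_inv A \<in> \<B>}"
  show "\<nu> \<in> \<B> \<rightarrow>\<^sub>E {0..1}" "\<mu> \<in> \<B> \<rightarrow>\<^sub>E {0..1}"
    using \<mu> \<nu> by (simp_all add: left_invariant_prob_def right_invariant_prob_def fin_add_prob_def)
  interpret B': stable_algebra G ?B by (rule stable_algebra_set_inv[OF bi])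
  have \<mu>_right: "right_invariant_prob G \<B> \<mu>"
    using left_invariant_prob_bi_invariant[OF bi \<mu>] by (simp add: bi_invariant_prob_def)
  have eq: "(\<lambda>A\<in>?B. \<nu> (set_inv A)) = (\<lambda>A\<in>?B. \<mu> (set_inv A))"
    by (rule B'.left_invariant_prob_unique[OF right_invariant_prob_set_inv[OF bi \<nu>]
          right_invariant_prob_set_inv[OF bi \<mu>_right]])
  fix A assume A: "A \<in> \<B>"
  then have "set_inv A \<in> ?B" using in_carrier[OF A] by (simp add: set_inv_subset set_inv_set_inv)
  then show "\<nu> A = \<mu> A"
    using fun_cong[OF eq, of "set_inv A"] in_carrier[OF A] by (simp add: set_inv_set_inv)
qed

end

text \<open>The later clauses range over all left-invariant \<open>\<mu>\<close>; by the first
  clause there is exactly one. The counting formula is asserted for every approximating pair, not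
  only for the pair constructed.\<close>

theorem theorem1p1:
  fixes G :: "('a, 'm) monoid_scheme" and \<B> :: "'a set set"
  assumes "Group.group G"
    and "Sigma_Algebra.algebra (carrier G) \<B>"
    and "left_invariant_sets G \<B>"
    and "\<forall>A\<in>\<B>. stable_in G A"
  shows "(\<exists>!\<mu>. left_invariant_prob G \<B> \<mu>) \<and>
    (\<forall>\<mu>. left_invariant_prob G \<B> \<mu> \<longrightarrow>
       (\<forall>A\<in>\<B>. \<mu> A > 0 \<longleftrightarrow> generic_in G A) \<and>
       (\<forall>A\<in>\<B>. (\<exists>H Y. coset_approx G \<B> \<mu> A H Y) \<and>
          (\<forall>H Y. coset_approx G \<B> \<mu> A H Y \<longrightarrow>
             \<mu> A = \<mu> Y \<and>
             \<mu> Y = real (card {C \<in> lcosets\<^bsub>G\<^esub> H. C \<subseteq> Y}) / real (card (lcosets\<^bsub>G\<^esub> H)))) \<and>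
       (bi_invariant_sets G \<B> \<longrightarrow>
          bi_invariant_prob G \<B> \<mu> \<and>
          (\<forall>\<nu>. right_invariant_prob G \<B> \<nu> \<longrightarrow> \<nu> = \<mu>) \<and>
          (\<forall>A\<in>\<B>. \<exists>H Y. H \<lhd> G \<and> coset_approx G \<B> \<mu> A H Y)))"
proof -
  interpret stable_algebra G \<B>
    using assms by (intro stable_algebra.intro left_invariant_algebra.intro
        left_invariant_algebra_axioms.intro stable_algebra_axioms.intro)
      (auto simp: left_invariant_sets_def)
  have "\<exists>!\<mu>. left_invariant_prob G \<B> \<mu>"
    using left_invariant_prob_exists left_invariant_prob_unique by blast
  moreover have "\<exists>H Y. coset_approx G \<B> \<mu> A H Y"
    if "left_invariant_prob G \<B> \<mu>" "A \<in> \<B>" for \<mu> A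
    using coset_approx_exists that by blast
  moreover have "\<exists>H Y. H \<lhd> G \<and> coset_approx G \<B> \<mu> A H Y"
    if "left_invariant_prob G \<B> \<mu>" "bi_invariant_sets G \<B>" "A \<in> \<B>" for \<mu> A
    using coset_approx_exists that by blast
  ultimately show ?thesis
    by (intro conjI allI impI ballI prob_pos_iff_generic coset_approx_value
        left_invariant_prob_bi_invariant right_invariant_prob_eq) simp_all
qed

end
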